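(* Let $k\in\mathbb{N}$, $\lambda_1,\dots,\lambda_k>0$, $\Lambda=\lambda_1+\dots+\lambda_k$, $c>0$. Consider the risk model with surplus $U(t)=u+ct-\sum_{i=1}^{M(t)}Z_i$, where $M$ is the generalized counting process with parameters $\lambda_1,\dots,\lambda_k$ and the claims $Z_i$ are i.i.d., independent of $M$, with gamma density $$f_Z(x)=\frac{\alpha^r}{\Gamma(r)}x^{r-1}e^{-\alpha x},\quad x>0,$$ for some $r>0$, $\alpha>0$. Let $\phi(u)$ be the non-ruin probability with initial capital $u\ge0$. Then for any $u>0$ $$\phi(u)=\phi(0)+e^{-\alpha u}\phi(0)\left\{e^{\alpha u}\ast\sum_{n=1}^\infty\left(\frac{\Lambda}{c}\right)^n\left[e^{\alpha u}-\frac1\Lambda\sum_{j=1}^k\lambda_j(\alpha u)^{jr}E_{1,1+jr}(\alpha u)\right]^{\ast n}\right\},$$ where $\ast$ denotes convolution and $f^{\ast n}$ the $n$-fold convolution power (of functions of $u$).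
   Context: The generalized counting process $M(t)$, $t\ge0$, with parameters $\lambda_1,\dots,\lambda_k>0$ is the counting process ($\mathbb{N}_0$-valued) with $M(0)=0$ a.s., stationary and independent increments, $\mathsf{P}\{M(h)=j\}=\lambda_jh+o(h)$ for $j=1,\dots,k$, and $\mathsf{P}\{M(h)>k\}=o(h)$ as $h\downarrow 0$. The time to ruin is $\tau=\inf\{t>0:U(t)<0\}$ (with $\inf\emptyset=\infty$), the ruin probability is $\psi(u)=\mathsf{P}\{\tau<\infty\}$, and the non-ruin probability is $\phi(u)=1-\psi(u)$, $u\ge0$. Convolution of functions on $[0,\infty)$: $(f\ast g)(u)=\int_0^uf(u-v)g(v)\,dv$; $f^{\ast1}=f$, $f^{\ast(n+1)}=f\ast f^{\ast n}$. $E_{\alpha,\beta}(z)=\sum_{r=0}^\infty\frac{z^r}{\Gamma(\alpha r+\beta)}$ is the two-parameter Mittag-Leffler function. *)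

theory Defs
  imports "HOL-Probability.Probability" "HOL-Library.Landau_Symbols"
begin

(* Monotone right-continuous paths are required for every outcome rather than almost surely, so
   that the ruin event is measurable without completing the probability space. Monotonicity also
   makes the truncated subtraction on nat harmless in the increments. *)
locale generalized_counting_process = prob_space P for P :: "'a measure" +
  fixes k :: nat and lam :: "nat \<Rightarrow> real" and M :: "real \<Rightarrow> 'a \<Rightarrow> nat"
  assumes k_ge_1: "1 \<le> k"
    and lam_pos: "\<And>j. j \<in> {1..k} \<Longrightarrow> 0 < lam j"
    and measurable_at: "\<And>t. 0 \<le> t \<Longrightarrow> M t \<in> measurable P (count_space UNIV)"
    and mono_paths: "\<And>\<omega>. \<omega> \<in> space P \<Longrightarrow> mono_on {0..} (\<lambda>t. M t \<omega>)"
    and right_continuous_paths: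
      "\<And>\<omega> t. \<omega> \<in> space P \<Longrightarrow> 0 \<le> t \<Longrightarrow> continuous (at_right t) (\<lambda>s. M s \<omega>)"
    and start: "AE \<omega> in P. M 0 \<omega> = 0"
    and stationary_increments:
      "\<And>s h. 0 \<le> s \<Longrightarrow> 0 \<le> h \<Longrightarrow>
        distr P (count_space UNIV) (\<lambda>\<omega>. M (s + h) \<omega> - M s \<omega>) =
        distr P (count_space UNIV) (\<lambda>\<omega>. M h \<omega> - M 0 \<omega>)"
    and independent_increments:
      "\<And>(n :: nat) (t :: nat \<Rightarrow> real). 0 \<le> t 0 \<Longrightarrow> (\<And>i. i < n \<Longrightarrow> t i < t (Suc i)) \<Longrightarrow>
        indep_vars (\<lambda>_. count_space UNIV) (\<lambda>i \<omega>. M (t (Suc i)) \<omega> - M (t i) \<omega>) {..<n}"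
    and jump_prob:
      "\<And>j. j \<in> {1..k} \<Longrightarrow>
        (\<lambda>h. prob {\<omega> \<in> space P. M h \<omega> = j} - lam j * h) \<in> o[at_right 0](\<lambda>h. h)"
    and large_jump_prob:
      "(\<lambda>h. prob {\<omega> \<in> space P. k < M h \<omega>}) \<in> o[at_right 0](\<lambda>h. h)"

definition gamma_density :: "real \<Rightarrow> real \<Rightarrow> real \<Rightarrow> real" where
  "gamma_density r \<alpha> x =
     (if 0 < x then \<alpha> powr r / Gamma r * x powr (r - 1) * exp (- \<alpha> * x) else 0)"

definition process_algebra ::
    "'a measure \<Rightarrow> 'i set \<Rightarrow> 'b measure \<Rightarrow> ('i \<Rightarrow> 'a \<Rightarrow> 'b) \<Rightarrow> 'a set set" where
  "process_algebra P I N X =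
     sets (vimage_algebra (space P) (\<lambda>\<omega>. \<lambda>i\<in>I. X i \<omega>) (PiM I (\<lambda>_. N)))"

definition surplus ::
    "real \<Rightarrow> (real \<Rightarrow> 'a \<Rightarrow> nat) \<Rightarrow> (nat \<Rightarrow> 'a \<Rightarrow> real) \<Rightarrow> real \<Rightarrow> real \<Rightarrow> 'a \<Rightarrow> real" where
  "surplus c M Z u t \<omega> = u + c * t - (\<Sum>i = 1..M t \<omega>. Z i \<omega>)"

definition ruin_time ::
    "real \<Rightarrow> (real \<Rightarrow> 'a \<Rightarrow> nat) \<Rightarrow> (nat \<Rightarrow> 'a \<Rightarrow> real) \<Rightarrow> real \<Rightarrow> 'a \<Rightarrow> ereal" where
  "ruin_time c M Z u \<omega> = Inf (ereal ` {t. 0 < t \<and> surplus c M Z u t \<omega> < 0})"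

definition ruin_prob ::
    "'a measure \<Rightarrow> real \<Rightarrow> (real \<Rightarrow> 'a \<Rightarrow> nat) \<Rightarrow> (nat \<Rightarrow> 'a \<Rightarrow> real) \<Rightarrow> real \<Rightarrow> real" where
  "ruin_prob P c M Z u = measure P {\<omega> \<in> space P. ruin_time c M Z u \<omega> < \<infinity>}"

definition nonruin_prob ::
    "'a measure \<Rightarrow> real \<Rightarrow> (real \<Rightarrow> 'a \<Rightarrow> nat) \<Rightarrow> (nat \<Rightarrow> 'a \<Rightarrow> real) \<Rightarrow> real \<Rightarrow> real" where
  "nonruin_prob P c M Z u = 1 - ruin_prob P c M Z u"

definition conv :: "(real \<Rightarrow> real) \<Rightarrow> (real \<Rightarrow> real) \<Rightarrow> real \<Rightarrow> real" where
  "conv f g u = (LBINT v:{0..u}. f (u - v) * g v)"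

(* The zeroth convolution power is deliberately left unspecified. *)
fun conv_power :: "(real \<Rightarrow> real) \<Rightarrow> nat \<Rightarrow> real \<Rightarrow> real" where
  "conv_power f (Suc 0) = f"
| "conv_power f (Suc (Suc n)) = conv f (conv_power f (Suc n))"

definition mittag_leffler :: "real \<Rightarrow> real \<Rightarrow> real \<Rightarrow> real" where
  "mittag_leffler a b z = (\<Sum>n. z ^ n / Gamma (a * real n + b))"

end

theory Submission
  imports Defs
begin

text \<open>
Until the next claims arrive the surplus grows linearly, and groups of \<open>j\<close> claims arrive at rate
\<open>lam j\<close>. Hence the non-ruin probability \<open>\<phi>\<close>, extended by 0 to negative capital, should satisfy
\<open>c \<phi>'(x) = \<Lambda> \<phi>(x) - \<Sum>j. lam j E \<phi>(x - S j)\<close>, where \<open>S j\<close> is the sum of \<open>j\<close> claims.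
Integrating this equation over \<open>[0, a]\<close> and interchanging integrals gives the renewal equation
\<open>\<phi> = \<phi>(0) + (\<Lambda>/c) (1 - F) * \<phi>\<close>, where \<open>F\<close> is the distribution function of the total claim
brought by one jump and \<open>*\<close> is convolution. The law of \<open>S j\<close> is the gamma law with shape \<open>j r\<close>, whose
distribution function at \<open>x\<close> is \<open>exp (- \<alpha> x) (\<alpha> x) powr (j r)\<close> times a Mittag-Leffler function; this
says exactly that \<open>exp (\<alpha> x) (1 - F x)\<close> is the function \<open>g\<close> of the statement. After multiplication by
\<open>exp (\<alpha> x)\<close> the renewal equation becomes a Volterra equation with kernel \<open>g\<close>, and its solution is
the forcing term plus its convolution with a series over convolution powers of \<open>g\<close> (\<open>Volterra_resolvent\<close>).
The Volterra equation determines its solution, so the case \<open>\<phi>(0) = 0\<close>, in which ruin is certain, needs no separate treatment.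

The equation for \<open>\<phi>\<close> is obtained without differentiating \<open>\<phi>\<close> and without a Markov property for paths.
Observe the surplus only at the multiples of \<open>h = (1/2)^n\<close>. Its increments are then independent and
identically distributed, so the probability \<open>f\<close> of never being negative at these times is a fixed
point of a one-step operator (\<open>never_ruined_fixed_point\<close>):
\<open>f x = E f(x + c h - S(M h))\<close> for \<open>x \<ge> 0\<close>. The axioms on small times give
\<open>P(M h = j) = lam j h + o(h)\<close>, so \<open>f (x + c h) - f x\<close> is \<open>h\<close> times the right-hand side above at
\<open>x + c h\<close>, with \<open>f\<close> for \<open>\<phi>\<close>, up to \<open>o(h)\<close>, uniformly in \<open>x \<ge> 0\<close>. Integrating over \<open>x \<in> [0, a]\<close> makes the
left-hand side telescope to averages of \<open>f\<close> over intervals of length \<open>c h\<close>, and monotonicity of \<open>f\<close> controls these. As \<open>n\<close> grows, \<open>f\<close>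
converges pointwise to \<open>\<phi>\<close>, since a right-continuous path that is negative at some time is negative at
some dyadic time; dominated convergence then yields the integrated equation
(\<open>integro_differential_limit\<close>).
\<close>

section \<open>Convolution and Volterra equations\<close>

lemma conv_commute: "conv f g u = conv g f u"
proof -
  have "conv f g u = (\<integral>v. indicator {0..u} v * (f (u - v) * g v) \<partial>lborel)"
    by (simp add: conv_def set_lebesgue_integral_def)
  also have "\<dots> = (\<integral>v. indicator {0..u} (u - v) * (f (u - (u - v)) * g (u - v)) \<partial>lborel)"
    by (subst lborel_integral_real_affine[where c = "-1" and t = u]) simp_all
  also have "\<dots> = (\<integral>v. indicator {0..u} v * (g (u - v) * f v) \<partial>lborel)"
    by (intro Bochner_Integration.integral_cong) (auto simp: indicator_def)
  finally show ?thesis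
    by (simp add: conv_def set_lebesgue_integral_def)
qed

lemma borel_measurable_conv [measurable]:
  assumes [measurable]: "f \<in> borel_measurable borel" "g \<in> borel_measurable borel"
  shows "conv f g \<in> borel_measurable borel"
proof -
  have "conv f g = (\<lambda>u. \<integral>v. (if 0 \<le> v \<and> v \<le> u then f (u - v) * g v else 0) \<partial>lborel)"
    by (auto simp: conv_def set_lebesgue_integral_def indicator_def fun_eq_iff
        intro!: Bochner_Integration.integral_cong)
  also have "\<dots> \<in> borel_measurable borel"
    by measurable
  finally show ?thesis .
qed

lemma set_integrable_conv:
  fixes f g :: "real \<Rightarrow> real"
  assumes [measurable]: "f \<in> borel_measurable borel" "g \<in> borel_measurable borel"
    and "\<And>x. x \<in> {0..u} \<Longrightarrow> \<bar>f x\<bar> \<le> A" "\<And>x. x \<in> {0..u} \<Longrightarrow> \<bar>g x\<bar> \<le> B"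
  shows "set_integrable lborel {0..u} (\<lambda>v. f (u - v) * g v)"
  unfolding set_integrable_def
proof (rule integrableI_bounded_set_indicator[where B = "A * B"])
  show "AE x in lborel. x \<in> {0..u} \<longrightarrow> norm (f (u - x) * g x) \<le> A * B"
  proof (intro AE_I2 impI)
    fix x assume "x \<in> {0..u}"
    then have "\<bar>f (u - x)\<bar> \<le> A" "\<bar>g x\<bar> \<le> B"
      using assms(3)[of "u - x"] assms(4)[of x] by auto
    then show "norm (f (u - x) * g x) \<le> A * B"
      by (simp add: abs_mult mult_mono')
  qed
qed (auto simp: emeasure_lborel_Icc_eq)

text \<open>
Both sides are the integral of \<open>f v * g w * h (u - v - w)\<close> over the triangle
\<open>v, w \<ge> 0, v + w \<le> u\<close>, taken in the two possible orders.
\<close>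

lemma conv_left_commute:
  assumes [measurable]: "f \<in> borel_measurable borel" "g \<in> borel_measurable borel"
      "h \<in> borel_measurable borel"
    and bf: "\<And>x. x \<in> {0..u} \<Longrightarrow> \<bar>f x\<bar> \<le> A" and bg: "\<And>x. x \<in> {0..u} \<Longrightarrow> \<bar>g x\<bar> \<le> B"
    and bh: "\<And>x. x \<in> {0..u} \<Longrightarrow> \<bar>h x\<bar> \<le> C"
  shows "conv f (conv g h) u = conv g (conv f h) u"
proof -
  \<comment> \<open>The common integrand; exchanging f and g amounts to exchanging v and w.\<close>
  define K where
    "K v w = (if 0 \<le> v \<and> 0 \<le> w \<and> v + w \<le> u then f v * g w * h (u - v - w) else 0)" for v w
  have unfold: "conv p (conv q h) u =
      (\<integral>v. (\<integral>w. (if 0 \<le> v \<and> 0 \<le> w \<and> v + w \<le> u then p v * q w * h (u - v - w) else 0) \<partial>lborel) \<partial>lborel)"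
    for p q
  proof -
    have "conv q h = conv h q"
      by (rule ext) (rule conv_commute)
    then have "conv p (conv q h) u = conv (conv h q) p u"
      using conv_commute[of p "conv h q" u] by simp
    also have "\<dots> = (\<integral>v. indicator {0..u} v * (conv h q (u - v) * p v) \<partial>lborel)"
      by (simp add: conv_def[of "conv h q"] set_lebesgue_integral_def)
    also have "\<dots> = (\<integral>v. (\<integral>w. (if 0 \<le> v \<and> 0 \<le> w \<and> v + w \<le> u then p v * q w * h (u - v - w) else 0) \<partial>lborel) \<partial>lborel)"
    proof (rule Bochner_Integration.integral_cong[OF refl])
      fix v
      have "indicator {0..u} v * (conv h q (u - v) * p v) =
          (\<integral>w. indicator {0..u} v * p v * (indicator {0..u - v} w * (h (u - v - w) * q w)) \<partial>lborel)"
        by (simp add: conv_def set_lebesgue_integral_def)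
      also have "\<dots> = (\<integral>w. (if 0 \<le> v \<and> 0 \<le> w \<and> v + w \<le> u then p v * q w * h (u - v - w) else 0) \<partial>lborel)"
        by (rule Bochner_Integration.integral_cong) (auto simp: indicator_def)
      finally show "indicator {0..u} v * (conv h q (u - v) * p v) = \<dots>" .
    qed
    finally show ?thesis .
  qed
  have "integrable (lborel \<Otimes>\<^sub>M lborel) (\<lambda>(v, w). K v w)"
  proof (rule integrableI_bounded_set[where A = "{0..u} \<times> {0..u}" and B = "A * B * C"])
    show "(\<lambda>(v, w). K v w) \<in> borel_measurable (lborel \<Otimes>\<^sub>M lborel)"
      unfolding K_def by measurable
    show "emeasure (lborel \<Otimes>\<^sub>M lborel) ({0..u} \<times> {0..u}) < \<infinity>"
      by (subst lborel.emeasure_pair_measure_Times) (auto simp: emeasure_lborel_Icc_eq ennreal_mult_less_top)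
    show "AE x in lborel \<Otimes>\<^sub>M lborel. x \<in> {0..u} \<times> {0..u} \<longrightarrow> norm (case x of (v, w) \<Rightarrow> K v w) \<le> A * B * C"
    proof (intro AE_I2 impI, clarify)
      fix v w assume vw: "v \<in> {0..u}" "w \<in> {0..u}"
      have nn: "0 \<le> A" "0 \<le> B" "0 \<le> C"
        using bf[OF vw(1)] bg[OF vw(1)] bh[OF vw(1)] by auto
      show "norm (K v w) \<le> A * B * C"
      proof (cases "v + w \<le> u")
        case True
        then have "\<bar>f v\<bar> \<le> A" "\<bar>g w\<bar> \<le> B" "\<bar>h (u - v - w)\<bar> \<le> C"
          using vw bf[of v] bg[of w] bh[of "u - v - w"] by auto
        then show ?thesis
          using nn by (auto simp: K_def abs_mult intro!: mult_mono)
      qed (use nn in \<open>simp add: K_def\<close>)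
    qed
  qed (auto intro!: AE_I2 simp: K_def split: if_splits)
  then have "(\<integral>w. \<integral>v. K v w \<partial>lborel \<partial>lborel) = (\<integral>v. \<integral>w. K v w \<partial>lborel \<partial>lborel)"
    by (rule lborel_pair.Fubini_integral)
  moreover have "(\<integral>v. \<integral>w. K v w \<partial>lborel \<partial>lborel) = conv f (conv g h) u"
    by (simp add: unfold K_def)
  moreover have "(\<integral>w. \<integral>v. K v w \<partial>lborel \<partial>lborel) = conv g (conv f h) u"
    unfolding unfold K_def
    by (intro Bochner_Integration.integral_cong refl) (auto simp: algebra_simps)
  ultimately show ?thesis by simp
qed

lemma borel_measurable_conv_iterate [measurable]:
  assumes [measurable]: "g \<in> borel_measurable borel" "F \<in> borel_measurable borel"
  shows "(conv g ^^ n) F \<in> borel_measurable borel"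
  by (induction n) simp_all

text \<open>
The factorial is the volume of a simplex: it makes the resolvent series converge for every
coefficient, however large.
\<close>

lemma conv_iterate_bound:
  assumes [measurable]: "g \<in> borel_measurable borel" "F \<in> borel_measurable borel"
    and g: "\<And>x. x \<in> {0..u} \<Longrightarrow> \<bar>g x\<bar> \<le> B" and F: "\<And>x. x \<in> {0..u} \<Longrightarrow> \<bar>F x\<bar> \<le> C"
    and "x \<in> {0..u}"
  shows "\<bar>(conv g ^^ n) F x\<bar> \<le> C * (B * x) ^ n / fact n"
  using \<open>x \<in> {0..u}\<close>
proof (induction n arbitrary: x)
  case 0
  then show ?case using F by simp
next
  case (Suc n)
  let ?G = "(conv g ^^ n) F"
  have nn: "0 \<le> B" "0 \<le> C" using g[OF Suc.prems] F[OF Suc.prems] by auto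
  have x: "0 \<le> x" "x \<le> u" using Suc.prems by auto
  have int: "integrable lborel (\<lambda>v. v ^ n * indicator {0..x} v)"
    using borel_integrable_atLeastAtMost'[of 0 x "\<lambda>v. v ^ n"]
    by (simp add: set_integrable_def mult.commute continuous_intros)
  have "norm (\<integral>v. indicator {0..x} v *\<^sub>R (g (x - v) * ?G v) \<partial>lborel) \<le> (\<integral>v. B * C * B ^ n / fact n * (v ^ n * indicator {0..x} v) \<partial>lborel)"
  proof (rule Bochner_Integration.integral_norm_bound_integral)
    fix v
    show "norm (indicator {0..x} v *\<^sub>R (g (x - v) * ?G v))
        \<le> B * C * B ^ n / fact n * (v ^ n * indicator {0..x} v)"
    proof (cases "v \<in> {0..x}")
      case True
      then have "\<bar>g (x - v)\<bar> \<le> B" "\<bar>?G v\<bar> \<le> C * (B * v) ^ n / fact n"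
        using x g[of "x - v"] Suc.IH[of v] by auto
      then have "\<bar>g (x - v)\<bar> * \<bar>?G v\<bar> \<le> B * (C * (B * v) ^ n / fact n)"
        using nn by (intro mult_mono) auto
      then show ?thesis
        using True by (simp add: abs_mult power_mult_distrib mult_ac)
    qed simp
  next
    show "integrable lborel (\<lambda>v. indicator {0..x} v *\<^sub>R (g (x - v) * ?G v))"
      unfolding set_integrable_def[symmetric]
    proof (rule set_integrable_conv[where A = B and B = "C * (B * u) ^ n / fact n"])
      fix v assume "v \<in> {0..x}"
      then show "\<bar>g v\<bar> \<le> B" "\<bar>?G v\<bar> \<le> C * (B * u) ^ n / fact n"
        using x nn g[of v] Suc.IH[of v]
        by (auto intro!: order.trans[OF Suc.IH[of v]] divide_right_mono mult_left_mono power_mono)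
    qed simp_all
    show "integrable lborel (\<lambda>v. B * C * B ^ n / fact n * (v ^ n * indicator {0..x} v))"
      using int by simp
  qed
  also have "\<dots> = B * C * B ^ n / fact n * (x ^ Suc n / Suc n)"
    using x by (simp add: integral_power[of 0 x n])
  also have "\<dots> = C * (B * x) ^ Suc n / fact (Suc n)"
    by (simp add: power_mult_distrib field_simps)
  finally show ?case
    by (simp add: conv_def[of g ?G] set_lebesgue_integral_def)
qed

lemma conv_power_eq_iterate: "conv_power g (Suc n) = (conv g ^^ n) g"
  by (induction n) auto

lemma conv_add_right:
  assumes "set_integrable lborel {0..u} (\<lambda>v. f (u - v) * g v)"
    and "set_integrable lborel {0..u} (\<lambda>v. f (u - v) * h v)"
  shows "conv f (\<lambda>x. g x + h x) u = conv f g u + conv f h u"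
  using set_integral_add(2)[OF assms] by (simp add: conv_def algebra_simps)

lemma conv_cmult_right: "conv f (\<lambda>x. a * g x) u = a * conv f g u"
  using set_integral_mult_right[of lborel "{0..u}" a "\<lambda>v. f (u - v) * g v"]
  by (simp add: conv_def mult_ac)

lemma conv_cong:
  assumes "\<And>x. x \<in> {0..u} \<Longrightarrow> f x = f' x" "\<And>x. x \<in> {0..u} \<Longrightarrow> g x = g' x"
  shows "conv f g u = conv f' g' u"
  unfolding conv_def
  by (rule set_lebesgue_integral_cong) (auto simp: assms)

text \<open>
Moving the forcing term \<open>e\<close> out of the iterated kernel is what turns Picard iteration of the Volterra
equation into a single convolution of \<open>e\<close> with the resolvent series.
\<close>

lemma conv_iterate_shift:
  assumes [measurable]: "g \<in> borel_measurable borel" "e \<in> borel_measurable borel"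
    and g: "\<And>x. x \<in> {0..u} \<Longrightarrow> \<bar>g x\<bar> \<le> B" and e: "\<And>x. x \<in> {0..u} \<Longrightarrow> \<bar>e x\<bar> \<le> D"
    and "x \<in> {0..u}"
  shows "(conv g ^^ Suc n) e x = conv e ((conv g ^^ n) g) x"
  using \<open>x \<in> {0..u}\<close>
proof (induction n arbitrary: x)
  case 0
  then show ?case by (simp add: conv_commute)
next
  case (Suc n)
  have nn: "0 \<le> B" using g[OF Suc.prems] by auto
  have "(conv g ^^ Suc (Suc n)) e x = conv g ((conv g ^^ Suc n) e) x"
    by simp
  also have "\<dots> = conv g (conv e ((conv g ^^ n) g)) x"
    using Suc.prems by (intro conv_cong Suc.IH) auto
  also have "\<dots> = conv e (conv g ((conv g ^^ n) g)) x"
  proof (rule conv_left_commute[where A = B and B = D and C = "B * (B * u) ^ n / fact n"])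
    fix y assume y: "y \<in> {0..x}"
    then have y': "y \<in> {0..u}" using Suc.prems by auto
    show "\<bar>g y\<bar> \<le> B" "\<bar>e y\<bar> \<le> D" using g e y' by auto
    have "\<bar>(conv g ^^ n) g y\<bar> \<le> B * (B * y) ^ n / fact n"
      using y' by (intro conv_iterate_bound[where u = u]) (auto intro: g)
    also have "\<dots> \<le> B * (B * u) ^ n / fact n"
      using y' nn by (intro divide_right_mono mult_left_mono power_mono) auto
    finally show "\<bar>(conv g ^^ n) g y\<bar> \<le> B * (B * u) ^ n / fact n" .
  qed simp_all
  finally show ?case by simp
qed

text \<open>
Substituting the equation \<open>F = a e + q (g * F)\<close> into itself repeatedly expresses \<open>F\<close> as a partial sum
of terms \<open>a q^n (g * (g * ... * e))\<close> plus a remainder bounded by a power over a factorial. Hence the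
bounded measurable solution is unique.
\<close>

theorem Volterra_resolvent:
  fixes g e F :: "real \<Rightarrow> real" and a q u :: real
  defines "S \<equiv> \<lambda>x. \<Sum>n. q ^ Suc n * conv_power g (Suc n) x"
  assumes meas [measurable]: "g \<in> borel_measurable borel" "e \<in> borel_measurable borel"
      "F \<in> borel_measurable borel"
    and u: "0 \<le> u"
    and g: "\<And>x. x \<in> {0..u} \<Longrightarrow> \<bar>g x\<bar> \<le> B" and e: "\<And>x. x \<in> {0..u} \<Longrightarrow> \<bar>e x\<bar> \<le> D"
    and F: "\<And>x. x \<in> {0..u} \<Longrightarrow> \<bar>F x\<bar> \<le> C"
    and eq: "\<And>x. x \<in> {0..u} \<Longrightarrow> F x = a * e x + q * conv g F x"
  shows "\<And>x. x \<in> {0..u} \<Longrightarrow> summable (\<lambda>n. q ^ Suc n * conv_power g (Suc n) x)"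
    and "set_integrable lborel {0..u} (\<lambda>v. e (u - v) * S v)"
    and "F u = a * e u + a * conv e S u"
proof -
  have nn: "0 \<le> B" "0 \<le> D" "0 \<le> C" using g[of 0] e[of 0] F[of 0] u by auto
  have iter_bound: "\<bar>(conv g ^^ n) G x\<bar> \<le> K * (B * u) ^ n / fact n"
    if [measurable]: "G \<in> borel_measurable borel" and G: "\<And>x. x \<in> {0..u} \<Longrightarrow> \<bar>G x\<bar> \<le> K"
      and x: "x \<in> {0..u}" for n G x K
  proof -
    have "0 \<le> K" using G[OF x] by simp
    have "\<bar>(conv g ^^ n) G x\<bar> \<le> K * (B * x) ^ n / fact n"
      using x by (intro conv_iterate_bound[where u = u]) (auto intro: g G)
    also have "\<dots> \<le> K * (B * u) ^ n / fact n"
      using x nn \<open>0 \<le> K\<close> by (intro divide_right_mono mult_left_mono power_mono) auto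
    finally show ?thesis .
  qed
  define t where "t n x = q ^ Suc n * conv_power g (Suc n) x" for n x
  define b where "b n = \<bar>q\<bar> * B * ((\<bar>q\<bar> * B * u) ^ n / fact n)" for n
  have [measurable]: "t n \<in> borel_measurable borel" for n
    unfolding t_def conv_power_eq_iterate by measurable
  have summable_b: "summable b"
    unfolding b_def using summable_exp[of "\<bar>q\<bar> * B * u"]
    by (intro summable_mult) (simp add: field_simps)
  have t_le: "\<bar>t n x\<bar> \<le> b n" if "x \<in> {0..u}" for n x
  proof -
    have "\<bar>t n x\<bar> \<le> \<bar>q\<bar> ^ Suc n * (B * (B * u) ^ n / fact n)"
      unfolding t_def conv_power_eq_iterate abs_mult power_abs
      by (intro mult_left_mono iter_bound that g) auto
    also have "\<dots> = b n" by (simp add: b_def power_mult_distrib)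
    finally show ?thesis .
  qed
  have summable_t: "summable (\<lambda>n. t n x)" if "x \<in> {0..u}" for x
    using t_le[OF that] by (intro summable_comparison_test'[OF summable_b]) auto
  then show "\<And>x. x \<in> {0..u} \<Longrightarrow> summable (\<lambda>n. q ^ Suc n * conv_power g (Suc n) x)"
    by (simp add: t_def)
  have S_eq: "S = (\<lambda>x. \<Sum>n. t n x)" by (simp add: S_def t_def)
  have [measurable]: "S \<in> borel_measurable borel" unfolding S_eq by measurable
  have S_le: "\<bar>S x\<bar> \<le> suminf b" if "x \<in> {0..u}" for x
  proof -
    have sa: "summable (\<lambda>n. \<bar>t n x\<bar>)"
      using t_le[OF that] by (intro summable_comparison_test'[OF summable_b]) auto
    have "\<bar>S x\<bar> \<le> (\<Sum>n. \<bar>t n x\<bar>)" unfolding S_eq by (rule summable_rabs[OF sa])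
    also have "\<dots> \<le> suminf b" by (rule suminf_le[OF t_le[OF that] sa summable_b])
    finally show ?thesis .
  qed
  show "set_integrable lborel {0..u} (\<lambda>v. e (u - v) * S v)"
    by (rule set_integrable_conv[OF _ _ e S_le]) simp_all
  have iterate_eq: "(conv g ^^ n) F x = a * (conv g ^^ n) e x + q * (conv g ^^ Suc n) F x"
    if "x \<in> {0..u}" for n x
    using that
  proof (induction n arbitrary: x)
    case 0
    then show ?case using eq[OF 0] by simp
  next
    case (Suc n)
    have *: "set_integrable lborel {0..x} (\<lambda>v. g (x - v) * (s * (conv g ^^ m) G v))"
      if [measurable]: "G \<in> borel_measurable borel" and G: "\<And>x. x \<in> {0..u} \<Longrightarrow> \<bar>G x\<bar> \<le> K" for s m G K
    proof (rule set_integrable_conv[where A = B and B = "\<bar>s\<bar> * (K * (B * u) ^ m / fact m)"])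
      fix y assume "y \<in> {0..x}"
      then have "y \<in> {0..u}" using Suc.prems by auto
      then show "\<bar>g y\<bar> \<le> B" "\<bar>s * (conv g ^^ m) G y\<bar> \<le> \<bar>s\<bar> * (K * (B * u) ^ m / fact m)"
        by (simp_all only: abs_mult mult_left_mono[OF iter_bound[OF _ G]] g that abs_ge_zero)
    qed simp_all
    have "(conv g ^^ Suc n) F x = conv g ((conv g ^^ n) F) x" by simp
    also have "\<dots> = conv g (\<lambda>x. a * (conv g ^^ n) e x + q * (conv g ^^ Suc n) F x) x"
      using Suc.prems by (intro conv_cong Suc.IH) auto
    also have "\<dots> = a * conv g ((conv g ^^ n) e) x + q * conv g ((conv g ^^ Suc n) F) x"
      using conv_add_right[OF *[OF meas(2) e, where s = a and m = n]
        *[OF meas(3) F, where s = q and m = "Suc n"]]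
      by (simp add: conv_cmult_right)
    finally show ?case by simp
  qed
  \<comment> \<open>The Neumann series with remainder after N substitutions.\<close>
  have partial: "F x = (\<Sum>n<N. a * q ^ n * (conv g ^^ n) e x) + q ^ N * (conv g ^^ N) F x"
    if "x \<in> {0..u}" for N x
  proof (induction N)
    case (Suc N)
    have "q ^ N * (conv g ^^ N) F x = a * q ^ N * (conv g ^^ N) e x + q ^ Suc N * (conv g ^^ Suc N) F x"
      by (subst iterate_eq[OF that]) (simp add: algebra_simps)
    then show ?case using Suc by simp
  qed simp
  have "(\<lambda>n. q ^ n * (conv g ^^ n) F u) \<longlonglongrightarrow> 0"
  proof (rule Lim_null_comparison)
    show "\<forall>\<^sub>F n in sequentially. norm (q ^ n * (conv g ^^ n) F u) \<le> C * ((\<bar>q\<bar> * B * u) ^ n / fact n)"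
    proof (rule always_eventually, rule allI)
      fix n
      have "\<bar>q ^ n\<bar> * \<bar>(conv g ^^ n) F u\<bar> \<le> \<bar>q ^ n\<bar> * (C * (B * u) ^ n / fact n)"
        using u by (intro mult_left_mono iter_bound F) auto
      then show "norm (q ^ n * (conv g ^^ n) F u) \<le> C * ((\<bar>q\<bar> * B * u) ^ n / fact n)"
        by (simp add: abs_mult power_abs power_mult_distrib mult_ac)
    qed
    show "(\<lambda>n. C * ((\<bar>q\<bar> * B * u) ^ n / fact n)) \<longlonglongrightarrow> 0"
      using summable_LIMSEQ_zero[OF summable_exp[of "\<bar>q\<bar> * B * u"]]
      by (intro tendsto_mult_right_zero) (simp add: field_simps)
  qed
  then have "(\<lambda>N. F u - q ^ N * (conv g ^^ N) F u) \<longlonglongrightarrow> F u"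
    by (auto intro: tendsto_eq_intros)
  moreover have "F u - q ^ N * (conv g ^^ N) F u = (\<Sum>n<N. a * q ^ n * (conv g ^^ n) e u)" for N
    using partial[of u N] u by simp
  ultimately have "(\<lambda>n. a * q ^ n * (conv g ^^ n) e u) sums F u"
    by (simp add: sums_def)
  then have "(\<lambda>n. a * q ^ Suc n * (conv g ^^ Suc n) e u) sums (F u - a * e u)"
    by (subst sums_Suc_iff) simp
  then have sums1: "(\<lambda>n. a * conv e (t n) u) sums (F u - a * e u)"
    using u unfolding t_def conv_power_eq_iterate conv_cmult_right
    by (subst (asm) conv_iterate_shift[OF meas(1,2) g e, of u]) (auto simp: mult_ac)
  have "(\<lambda>N. \<integral>v. indicator {0..u} v * (e (u - v) * (\<Sum>n<N. t n v)) \<partial>lborel)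
      \<longlonglongrightarrow> (\<integral>v. indicator {0..u} v * (e (u - v) * S v) \<partial>lborel)"
  proof (rule integral_dominated_convergence[where w = "\<lambda>v. indicator {0..u} v * (D * suminf b)"])
    show "integrable lborel (\<lambda>v. indicator {0..u} v * (D * suminf b))"
      using u by (intro integrable_mult_left) (auto simp: emeasure_lborel_Icc_eq)
    show "AE v in lborel. (\<lambda>N. indicator {0..u} v * (e (u - v) * (\<Sum>n<N. t n v)))
        \<longlonglongrightarrow> indicator {0..u} v * (e (u - v) * S v)"
    proof (rule AE_I2)
      fix v :: real
      show "(\<lambda>N. indicator {0..u} v * (e (u - v) * (\<Sum>n<N. t n v)))
        \<longlonglongrightarrow> indicator {0..u} v * (e (u - v) * S v)"
      proof (cases "v \<in> {0..u}")
        case True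
        then show ?thesis
          unfolding S_eq by (intro tendsto_mult tendsto_const summable_LIMSEQ summable_t)
      qed simp
    qed
    fix N
    show "AE v in lborel. norm (indicator {0..u} v * (e (u - v) * (\<Sum>n<N. t n v)))
        \<le> indicator {0..u} v * (D * suminf b)"
    proof (rule AE_I2)
      fix v :: real
      show "norm (indicator {0..u} v * (e (u - v) * (\<Sum>n<N. t n v)))
        \<le> indicator {0..u} v * (D * suminf b)"
      proof (cases "v \<in> {0..u}")
        case True
        have "\<bar>\<Sum>n<N. t n v\<bar> \<le> (\<Sum>n<N. b n)"
          by (rule order.trans[OF sum_abs sum_mono]) (rule t_le[OF True])
        also have "\<dots> \<le> suminf b"
          using nn u by (intro sum_le_suminf summable_b) (auto simp: b_def)
        finally have "\<bar>e (u - v)\<bar> * \<bar>\<Sum>n<N. t n v\<bar> \<le> D * suminf b"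
          using nn True e[of "u - v"] by (intro mult_mono) auto
        then show ?thesis using True by (simp add: abs_mult)
      qed simp
    qed
  qed measurable
  moreover have "(\<integral>v. indicator {0..u} v * (e (u - v) * (\<Sum>n<N. t n v)) \<partial>lborel) = (\<Sum>n<N. conv e (t n) u)"
    for N
  proof -
    have "(\<integral>v. indicator {0..u} v * (e (u - v) * (\<Sum>n<N. t n v)) \<partial>lborel) =
        (\<integral>v. (\<Sum>n<N. indicator {0..u} v * (e (u - v) * t n v)) \<partial>lborel)"
      by (simp add: sum_distrib_left)
    also have "\<dots> = (\<Sum>n<N. \<integral>v. indicator {0..u} v * (e (u - v) * t n v) \<partial>lborel)"
    proof (rule Bochner_Integration.integral_sum)
      fix n
      show "integrable lborel (\<lambda>v. indicator {0..u} v * (e (u - v) * t n v))"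
        using set_integrable_conv[where f = e and g = "t n" and u = u, OF _ _ e t_le]
        by (simp add: set_integrable_def)
    qed
    finally show ?thesis by (simp add: conv_def set_lebesgue_integral_def)
  qed
  ultimately have "(\<lambda>n. conv e (t n) u) sums conv e S u"
    by (simp add: sums_def conv_def[of e S] set_lebesgue_integral_def)
  then have "(\<lambda>n. a * conv e (t n) u) sums (a * conv e S u)"
    by (rule sums_mult)
  with sums1 have "F u - a * e u = a * conv e S u"
    by (rule sums_unique2)
  then show "F u = a * e u + a * conv e S u" by simp
qed

section \<open>Gamma distributions and the Mittag-Leffler function\<close>

lemma gamma_density_nonneg: "0 < a \<Longrightarrow> 0 \<le> gamma_density a l x"
  by (auto simp: gamma_density_def intro!: mult_nonneg_nonneg divide_nonneg_pos Gamma_real_pos)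

lemma borel_measurable_gamma_density [measurable]: "gamma_density a l \<in> borel_measurable borel"
  unfolding gamma_density_def[abs_def] by measurable

lemma nn_integral_gamma_density:
  assumes a: "0 < a" and l: "0 < l"
  shows "(\<integral>\<^sup>+x. gamma_density a l x \<partial>lborel) = 1"
proof -
  have G: "0 < Gamma a" using a by (rule Gamma_real_pos)
  have "ennreal (Gamma a) = (\<integral>\<^sup>+t. ennreal (indicator {0..} t * t powr (a - 1) / exp t) \<partial>lborel)"
    using a by (rule Gamma_conv_nn_integral_real)
  also have "\<dots> = ennreal l * (\<integral>\<^sup>+t. ennreal (indicator {0..} (l * t) * (l * t) powr (a - 1) / exp (l * t)) \<partial>lborel)"
    using l by (subst nn_integral_real_affine[where c = l and t = 0]) auto
  also have "\<dots> = (\<integral>\<^sup>+t. ennreal (Gamma a) * gamma_density a l t \<partial>lborel)"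
    using l G
    by (subst nn_integral_cmult[symmetric])
      (auto intro!: nn_integral_cong simp: gamma_density_def ennreal_mult[symmetric] powr_mult
        indicator_def exp_minus field_simps powr_diff zero_le_mult_iff)
  also have "\<dots> = ennreal (Gamma a) * (\<integral>\<^sup>+t. gamma_density a l t \<partial>lborel)"
    by (rule nn_integral_cmult) measurable
  finally have "ennreal (Gamma a) * 1 = ennreal (Gamma a) * (\<integral>\<^sup>+t. gamma_density a l t \<partial>lborel)"
    by simp
  then show ?thesis
    using G by (subst (asm) ennreal_mult_cancel_left) auto
qed

lemma prob_space_gamma_density:
  "0 < a \<Longrightarrow> 0 < l \<Longrightarrow> prob_space (density lborel (\<lambda>x. ennreal (gamma_density a l x)))"
  by (rule prob_spaceI) (simp add: emeasure_density nn_integral_gamma_density)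

text \<open>
Scaling the integration variable by \<open>x\<close> shows that the convolution is a constant multiple \<open>C\<close> of the
gamma density with shape \<open>a + b\<close>. Both functions integrate to 1, so \<open>C = 1\<close>; in this way the Beta integral
never has to be evaluated.
\<close>

lemma convolution_gamma_density:
  assumes a: "0 < a" and b: "0 < b" and l: "0 < l"
  shows "(\<lambda>x. \<integral>\<^sup>+y. ennreal (gamma_density a l (x - y)) * ennreal (gamma_density b l y) \<partial>lborel) =
    (\<lambda>x. ennreal (gamma_density (a + b) l x))" (is "?L = ?R")
proof -
  \<comment> \<open>The Beta integral, up to Gamma factors; it turns out to be 1.\<close>
  define C where "C = ennreal (Gamma (a + b) / (Gamma a * Gamma b)) *
    (\<integral>\<^sup>+y. ennreal (indicator {0<..<1} y * ((1 - y) powr (a - 1) * y powr (b - 1))) \<partial>lborel)"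
  have pos: "0 < Gamma a" "0 < Gamma b" "0 < Gamma (a + b)"
    using a b by (auto intro: Gamma_real_pos)
  have L: "?L x = C * gamma_density (a + b) l x" for x
  proof (cases "0 < x")
    case False
    then have "?L x = (\<integral>\<^sup>+(y::real). 0 \<partial>lborel)"
      by (intro nn_integral_cong) (auto simp: gamma_density_def)
    then show ?thesis using False by (simp add: gamma_density_def)
  next
    case True
    have "?L x = ennreal x *
        (\<integral>\<^sup>+y. ennreal (gamma_density a l (x - x * y)) * ennreal (gamma_density b l (x * y)) \<partial>lborel)"
      using True by (subst nn_integral_real_affine[where c = x and t = 0]) auto
    also have "\<dots> = (\<integral>\<^sup>+y. ennreal (Gamma (a + b) / (Gamma a * Gamma b) * gamma_density (a + b) l x) *
        ennreal (indicator {0<..<1} y * ((1 - y) powr (a - 1) * y powr (b - 1))) \<partial>lborel)"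
    proof (subst nn_integral_cmult[symmetric], simp, rule nn_integral_cong)
      fix y :: real
      show "ennreal x * (ennreal (gamma_density a l (x - x * y)) * ennreal (gamma_density b l (x * y))) =
        ennreal (Gamma (a + b) / (Gamma a * Gamma b) * gamma_density (a + b) l x) *
        ennreal (indicator {0<..<1} y * ((1 - y) powr (a - 1) * y powr (b - 1)))"
      proof (cases "0 < y \<and> y < 1")
        case False
        then show ?thesis using True
          by (auto simp: gamma_density_def indicator_def zero_less_mult_iff)
      next
        case y: True
        have xy: "x - x * y = x * (1 - y)" by (simp add: algebra_simps)
        have e: "exp (- (l * (x * (1 - y)))) * exp (- (l * (x * y))) = exp (- (l * x))"
          by (simp add: exp_add[symmetric] algebra_simps)
        have p: "x * (x powr (a - 1) * x powr (b - 1)) = x powr (a + b - 1)"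
          using True by (simp add: powr_add[symmetric] powr_mult_base algebra_simps)
        have q: "l powr a * l powr b = l powr (a + b)" by (simp add: powr_add)
        have "x * (gamma_density a l (x - x * y) * gamma_density b l (x * y)) =
           (l powr a * l powr b) / (Gamma a * Gamma b) * (x * (x powr (a - 1) * x powr (b - 1))) *
           ((1 - y) powr (a - 1) * y powr (b - 1)) *
           (exp (- (l * (x * (1 - y)))) * exp (- (l * (x * y))))"
          unfolding xy using y True by (simp add: gamma_density_def powr_mult)
        also have "\<dots> = (Gamma (a + b) / (Gamma a * Gamma b) * gamma_density (a + b) l x) *
            ((1 - y) powr (a - 1) * y powr (b - 1))"
          unfolding e p q using True pos by (simp add: gamma_density_def)
        finally show ?thesis
          using y True pos a b
          by (simp add: ennreal_mult[symmetric] gamma_density_nonneg mult.assoc)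
      qed
    qed
    also have "\<dots> = ennreal (Gamma (a + b) / (Gamma a * Gamma b) * gamma_density (a + b) l x) *
      (\<integral>\<^sup>+y. ennreal (indicator {0<..<1} y * ((1 - y) powr (a - 1) * y powr (b - 1))) \<partial>lborel)"
      by (rule nn_integral_cmult) measurable
    also have "\<dots> = C * gamma_density (a + b) l x"
      using pos a b by (subst ennreal_mult) (simp_all add: C_def gamma_density_nonneg mult_ac del: times_divide_eq_left times_divide_eq_right)
    finally show ?thesis .
  qed
  have "prob_space (density lborel ?L)"
    by (intro prob_space_convolution_density prob_space_gamma_density gamma_density_nonneg a b l) simp_all
  then have "(\<integral>\<^sup>+x. ?L x \<partial>lborel) = 1"
    by (auto dest!: prob_space.emeasure_space_1 simp: emeasure_density)
  then have "C * (\<integral>\<^sup>+x. gamma_density (a + b) l x \<partial>lborel) = 1"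
    unfolding L by (subst nn_integral_cmult[symmetric]) auto
  then have "C = 1"
    using a b l by (simp add: nn_integral_gamma_density)
  then show ?thesis by (simp add: L)
qed

lemma (in prob_space) gamma_distributed_sum:
  assumes "finite I" "I \<noteq> {}" and a: "0 < a" and l: "0 < l"
    and "\<And>i. i \<in> I \<Longrightarrow> distributed M lborel (X i) (\<lambda>x. ennreal (gamma_density a l x))"
    and "indep_vars (\<lambda>_. borel) X I"
  shows "distributed M lborel (\<lambda>x. \<Sum>i\<in>I. X i x)
    (\<lambda>x. ennreal (gamma_density (real (card I) * a) l x))"
  using assms(1,2,5,6)
proof (induction I rule: finite_ne_induct)
  case (singleton i)
  then show ?case by simp
next
  case (insert i I)
  have c: "0 < real (card I) * a" using insert.hyps a by (simp add: card_gt_0_iff)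
  have ind: "indep_var borel (X i) borel (\<lambda>x. \<Sum>i\<in>I. X i x)"
    using insert by (intro indep_vars_sum) auto
  have "distributed M lborel (\<lambda>x. X i x + (\<Sum>i\<in>I. X i x))
      (\<lambda>x. \<integral>\<^sup>+y. ennreal (gamma_density a l (x - y)) * ennreal (gamma_density (real (card I) * a) l y) \<partial>lborel)"
    using insert.prems
    by (intro distributed_convolution ind insert.IH) (auto intro: indep_vars_subset)
  then show ?case
    unfolding convolution_gamma_density[OF a c l]
    using insert.hyps by (simp add: algebra_simps)
qed

text \<open>
For \<open>E = mittag_leffler 1 (1 + a)\<close> this is the differential equation \<open>a E + x E' = 1 / Gamma a + x E\<close>,
read off from the coefficients with the functional equation of the Gamma function. It says that
\<open>x powr a * exp (- x) * E x\<close> is an antiderivative of the gamma density on the positive half-line.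
\<close>

lemma mittag_leffler_1_has_derivative:
  assumes a: "0 < a"
  shows "\<exists>D. (mittag_leffler 1 (1 + a) has_real_derivative D) (at x) \<and>
    a * mittag_leffler 1 (1 + a) x + x * D = 1 / Gamma a + x * mittag_leffler 1 (1 + a) x"
proof -
  define c where "c n = 1 / Gamma (real n + (1 + a))" for n
  have cpos: "0 < c n" for n using a by (simp add: c_def Gamma_real_pos)
  have cSuc: "c n = (real n + 1 + a) * c (Suc n)" for n
  proof -
    have "Gamma (real (Suc n) + (1 + a)) = (real n + 1 + a) * Gamma (real n + (1 + a))"
      using Gamma_plus1[of "real n + (1 + a)"] a by (auto simp: nonpos_Ints_def algebra_simps)
    then show ?thesis using a by (simp add: c_def)
  qed
  have c0: "a * c 0 = 1 / Gamma a"
    using Gamma_plus1[of a] a by (auto simp: c_def nonpos_Ints_def algebra_simps)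
  have c_le: "c n \<le> c 0 * inverse (fact n)" for n
  proof (induction n)
    case (Suc n)
    have "c (Suc n) * (real n + 1) \<le> c n"
      unfolding cSuc[of n] using a cpos[of "Suc n"] by (simp add: algebra_simps)
    also note Suc
    finally have "c (Suc n) * ((real n + 1) * fact n) \<le> c 0"
      by (simp add: field_simps)
    then have "c (Suc n) \<le> c 0 / ((real n + 1) * fact n)"
      by (subst pos_le_divide_eq) simp_all
    then show ?case by (simp add: field_simps)
  qed simp
  have summ: "summable (\<lambda>n. c n * y ^ n)" for y :: real
  proof (rule summable_comparison_test')
    show "summable (\<lambda>n. c 0 * (inverse (fact n) * \<bar>y\<bar> ^ n))"
      by (intro summable_mult summable_exp)
    show "norm (c n * y ^ n) \<le> c 0 * (inverse (fact n) * \<bar>y\<bar> ^ n)" for n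
      using mult_right_mono[OF c_le[of n], of "\<bar>y\<bar> ^ n"] cpos[of n]
      by (simp add: abs_mult power_abs mult_ac)
  qed
  have series_eq: "mittag_leffler 1 (1 + a) = (\<lambda>x. \<Sum>n. c n * x ^ n)"
    by (simp add: mittag_leffler_def c_def fun_eq_iff)
  have D: "((\<lambda>x. \<Sum>n. c n * x ^ n) has_real_derivative (\<Sum>n. diffs c n * x ^ n)) (at x)"
    by (rule termdiffs_strong[OF summ, where K = "\<bar>x\<bar> + 1"]) auto
  have summ_diffs: "summable (\<lambda>n. diffs c n * x ^ n)"
    by (rule termdiff_converges_all) (rule summ)
  have summ_Suc: "summable (\<lambda>n. c (Suc n) * x ^ n)"
  proof (rule summable_comparison_test'[OF summable_norm_cancel])
    show "summable (\<lambda>n. norm (c n * \<bar>x\<bar> ^ n))"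
      using summ[of "\<bar>x\<bar>"] cpos by (simp add: abs_mult less_imp_le)
    show "norm (c (Suc n) * x ^ n) \<le> c n * \<bar>x\<bar> ^ n" for n
    proof -
      have "c (Suc n) \<le> c n" unfolding cSuc[of n] using a cpos[of "Suc n"] by (simp add: algebra_simps)
      then show ?thesis using cpos[of "Suc n"] by (simp add: abs_mult power_abs mult_right_mono)
    qed
  qed
  have split: "(\<Sum>n. c n * x ^ n) = c 0 + x * (\<Sum>n. c (Suc n) * x ^ n)"
    using suminf_split_head[OF summ[of x]] suminf_mult[OF summ_Suc, of x] by (simp add: mult_ac)
  have "a * (\<Sum>n. c (Suc n) * x ^ n) + (\<Sum>n. diffs c n * x ^ n) = (\<Sum>n. a * (c (Suc n) * x ^ n) + diffs c n * x ^ n)"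
    by (simp add: suminf_add[symmetric] suminf_mult summ_Suc summ_diffs summable_mult)
  also have "\<dots> = (\<Sum>n. c n * x ^ n)"
    unfolding diffs_def by (subst (3) cSuc) (simp add: algebra_simps)
  finally have "a * (\<Sum>n. c (Suc n) * x ^ n) + (\<Sum>n. diffs c n * x ^ n) = (\<Sum>n. c n * x ^ n)" .
  then have "a * (\<Sum>n. c n * x ^ n) + x * (\<Sum>n. diffs c n * x ^ n) = a * c 0 + x * (\<Sum>n. c n * x ^ n)"
    using split by algebra
  then show ?thesis using D unfolding series_eq c0 by blast
qed

text \<open>
The density may be unbounded at 0, so the fundamental theorem of calculus is used in the form that
asks for differentiability only in the interior.
\<close>

lemma gamma_density_has_integral:
  assumes a: "0 < a" and l: "0 < l" and x: "0 \<le> x"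
  shows "(gamma_density a l has_integral
    (l * x) powr a * exp (- l * x) * mittag_leffler 1 (1 + a) (l * x)) {0..x}"
proof -
  define H where "H t = (l * t) powr a * exp (- l * t) * mittag_leffler 1 (1 + a) (l * t)" for t
  have cont_E: "continuous_on A (mittag_leffler 1 (1 + a))" for A
  proof (rule continuous_at_imp_continuous_on, rule ballI)
    fix t
    obtain D where "(mittag_leffler 1 (1 + a) has_real_derivative D) (at t)"
      using mittag_leffler_1_has_derivative[OF a] by blast
    then show "isCont (mittag_leffler 1 (1 + a)) t" by (rule DERIV_isCont)
  qed
  have "continuous_on {0..x} (\<lambda>t. mittag_leffler 1 (1 + a) (l * t))"
    by (rule continuous_on_compose2[OF cont_E[of UNIV]]) (auto intro!: continuous_intros)
  moreover have "continuous_on {0..x} (\<lambda>t. (l * t) powr a)"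
    using a l by (intro continuous_on_powr' continuous_intros) (auto simp: zero_le_mult_iff)
  ultimately have cont: "continuous_on {0..x} H"
    unfolding H_def by (intro continuous_on_mult continuous_on_exp continuous_on_const continuous_on_id)
  have "(gamma_density a l has_integral H x - H 0) {0..x}"
  proof (rule fundamental_theorem_of_calculus_interior[OF x cont])
    fix t assume t: "t \<in> {0<..<x}"
    obtain D where D: "(mittag_leffler 1 (1 + a) has_real_derivative D) (at (l * t))"
      and eq: "a * mittag_leffler 1 (1 + a) (l * t) + (l * t) * D =
        1 / Gamma a + (l * t) * mittag_leffler 1 (1 + a) (l * t)"
      using mittag_leffler_1_has_derivative[OF a] by blast
    have lt: "0 < l * t" using l t by auto
    let ?E = "mittag_leffler 1 (1 + a) (l * t)"
    have dE: "((\<lambda>t. mittag_leffler 1 (1 + a) (l * t)) has_real_derivative D * l) (at t)"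
      by (rule DERIV_chain2[where f = "mittag_leffler 1 (1 + a)" and g = "\<lambda>t. l * t", OF D]) (auto intro!: derivative_eq_intros)
    have dP: "((\<lambda>t. (l * t) powr a) has_real_derivative a * (l * t) powr (a - 1) * l) (at t)"
      using lt by (auto intro!: derivative_eq_intros simp: powr_diff)
    have dX: "((\<lambda>t. exp (- l * t)) has_real_derivative - l * exp (- l * t)) (at t)"
      by (auto intro!: derivative_eq_intros)
    have "(H has_real_derivative
        (a * (l * t) powr (a - 1) * l * exp (- l * t) + - l * exp (- l * t) * (l * t) powr a) * ?E +
          D * l * ((l * t) powr a * exp (- l * t))) (at t)"
      unfolding H_def by (intro DERIV_mult dE dP dX)
    also have "(a * (l * t) powr (a - 1) * l * exp (- l * t) + - l * exp (- l * t) * (l * t) powr a) * ?E +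
          D * l * ((l * t) powr a * exp (- l * t)) =
        l * exp (- l * t) * (l * t) powr (a - 1) * (a * ?E + (l * t) * D - (l * t) * ?E)"
    proof -
      have "(l * t) powr a = (l * t) powr (a - 1) * (l * t)"
        using lt powr_mult_base[of "l * t" "a - 1"] by (simp add: mult.commute)
      then show ?thesis by (simp only:) (simp add: algebra_simps)
    qed
    also have "\<dots> = gamma_density a l t"
      using lt t l unfolding eq
      by (simp add: gamma_density_def powr_mult powr_diff field_simps)
    finally show "(H has_vector_derivative gamma_density a l t) (at t)"
      by (simp add: has_real_derivative_iff_has_vector_derivative)
  qed
  then show ?thesis by (simp add: H_def)
qed

lemma gamma_cdf:
  assumes a: "0 < a" and l: "0 < l" and x: "0 \<le> x"
  shows "measure (density lborel (\<lambda>t. ennreal (gamma_density a l t))) {..x} =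
    (l * x) powr a * exp (- l * x) * mittag_leffler 1 (1 + a) (l * x)" (is "_ = ?V")
proof -
  note I = gamma_density_has_integral[OF assms]
  have "0 \<le> ?V"
    using gamma_density_nonneg[OF a] by (intro has_integral_nonneg[OF I]) auto
  have "emeasure (density lborel (\<lambda>t. ennreal (gamma_density a l t))) {..x} =
      (\<integral>\<^sup>+t. ennreal (indicator {0..x} t * gamma_density a l t) \<partial>lborel)"
    by (subst emeasure_density) (auto intro!: nn_integral_cong simp: indicator_def gamma_density_def)
  also have "\<dots> = ennreal ?V"
    using gamma_density_nonneg[OF a] by (intro nn_integral_has_integral_lebesgue[OF _ I]) auto
  finally show ?thesis
    using \<open>0 \<le> ?V\<close> by (simp add: measure_def)
qed

section \<open>Random walks with randomly many independent claims per step\<close>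

text \<open>
The surplus after \<open>n\<close> steps from capital \<open>x\<close>: every step earns the premium \<open>\<delta>\<close>, and step \<open>l\<close> consumes
the next \<open>d l\<close> claims of the sequence \<open>z\<close>, which is numbered from 1.
\<close>

definition claim_walk :: "real \<Rightarrow> (nat \<Rightarrow> nat) \<Rightarrow> (nat \<Rightarrow> real) \<Rightarrow> real \<Rightarrow> nat \<Rightarrow> real" where
  "claim_walk \<delta> d z x n = x + \<delta> * real n - (\<Sum>i = 1..(\<Sum>l<n. d l). z i)"

text \<open>
The initial value \<open>x\<close> itself is not tested. The indicator takes values in the extended reals since it
only occurs under nonnegative integrals.
\<close>

definition survival :: "real \<Rightarrow> (nat \<Rightarrow> nat) \<Rightarrow> (nat \<Rightarrow> real) \<Rightarrow> real \<Rightarrow> nat \<Rightarrow> ennreal" where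
  "survival \<delta> d z x N = (if \<forall>n\<in>{1..N}. 0 \<le> claim_walk \<delta> d z x n then 1 else 0)"

lemma claim_walk_cong:
  assumes "\<And>l. l < n \<Longrightarrow> d l = d' l" "\<And>i. 1 \<le> i \<Longrightarrow> i \<le> (\<Sum>l<n. d l) \<Longrightarrow> z i = z' i"
  shows "claim_walk \<delta> d z x n = claim_walk \<delta> d' z' x n"
proof -
  have "(\<Sum>l<n. d l) = (\<Sum>l<n. d' l)" using assms(1) by (intro sum.cong) auto
  moreover have "(\<Sum>i = 1..(\<Sum>l<n. d l). z i) = (\<Sum>i = 1..(\<Sum>l<n. d l). z' i)"
    using assms(2) by (intro sum.cong) auto
  ultimately show ?thesis by (simp add: claim_walk_def)
qed

lemma survival_cong:
  assumes "\<And>l. l < N \<Longrightarrow> d l = d' l" "\<And>i. 1 \<le> i \<Longrightarrow> i \<le> (\<Sum>l<N. d l) \<Longrightarrow> z i = z' i"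
  shows "survival \<delta> d z x N = survival \<delta> d' z' x N"
proof -
  have "claim_walk \<delta> d z x n = claim_walk \<delta> d' z' x n" if "n \<in> {1..N}" for n
  proof (rule claim_walk_cong)
    have "(\<Sum>l<n. d l) \<le> (\<Sum>l<N. d l)" using that by (intro sum_mono2) auto
    then show "z i = z' i" if "1 \<le> i" "i \<le> (\<Sum>l<n. d l)" for i
      using that assms(2) by simp
  qed (use assms(1) that in auto)
  then show ?thesis by (simp add: survival_def)
qed

lemma survival_Suc:
  "survival \<delta> d z x (Suc N) = survival \<delta> d z x N * indicator {0..} (claim_walk \<delta> d z x (Suc N))"
proof -
  have "{1..Suc N} = insert (Suc N) {1..N}" by auto
  then show ?thesis by (auto simp: survival_def indicator_def)
qed

lemma claim_walk_Suc:
  "claim_walk \<delta> d z x (Suc N) =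
    claim_walk \<delta> d z x N + \<delta> - (\<Sum>i\<in>{(\<Sum>l<N. d l)<..(\<Sum>l<N. d l) + d N}. z i)"
proof -
  let ?m = "\<Sum>l<N. d l"
  have "{1..?m + d N} = {1..?m} \<union> {?m<..?m + d N}" by auto
  then have "(\<Sum>i = 1..?m + d N. z i) = (\<Sum>i = 1..?m. z i) + (\<Sum>i\<in>{?m<..?m + d N}. z i)"
    by (simp add: sum.union_disjoint ivl_disj_int)
  then show ?thesis by (simp add: claim_walk_def algebra_simps)
qed

lemma measurable_sum_nat:
  fixes d :: "nat \<Rightarrow> 'q \<Rightarrow> nat"
  assumes "\<And>l. l < n \<Longrightarrow> d l \<in> measurable Q (count_space UNIV)"
  shows "(\<lambda>q. \<Sum>l<n. d l q) \<in> measurable Q (count_space UNIV)"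
  using assms
proof (induction n)
  case (Suc n)
  have "(\<lambda>q. (\<lambda>i q. i + d n q) (\<Sum>l<n. d l q) q) \<in> measurable Q (count_space UNIV)"
  proof (rule measurable_compose_countable[where f = "\<lambda>i q. i + d n q"])
    show "(\<lambda>q. \<Sum>l<n. d l q) \<in> measurable Q (count_space UNIV)" using Suc by simp
    show "(\<lambda>q. i + d n q) \<in> measurable Q (count_space UNIV)" for i
      using Suc.prems[of n] by (rule measurable_compose) auto
  qed
  then show ?case by simp
qed simp

text \<open>
The number of summands is random. It takes countably many values, and measurability can be checked
for each of them separately.
\<close>

lemma measurable_claim_walk:
  assumes d: "\<And>l. l < n \<Longrightarrow> (\<lambda>q. d q l) \<in> measurable Q (count_space UNIV)"
    and z: "\<And>i. 1 \<le> i \<Longrightarrow> (\<lambda>q. z q i) \<in> borel_measurable Q"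
  shows "(\<lambda>q. claim_walk \<delta> (d q) (z q) x n) \<in> borel_measurable Q"
proof -
  have "(\<lambda>q. (\<lambda>m q. \<Sum>i = 1..m. z q i) (\<Sum>l<n. d q l) q) \<in> borel_measurable Q"
  proof (rule measurable_compose_countable[where f = "\<lambda>m q. \<Sum>i = 1..m. z q i"])
    show "(\<lambda>q. \<Sum>l<n. d q l) \<in> measurable Q (count_space UNIV)"
      using d by (rule measurable_sum_nat)
    show "(\<lambda>q. \<Sum>i = 1..m. z q i) \<in> borel_measurable Q" for m
      using z by (intro borel_measurable_sum) auto
  qed
  then show ?thesis unfolding claim_walk_def by simp
qed

lemma measurable_survival:
  assumes "\<And>n. n \<in> {1..N} \<Longrightarrow> (\<lambda>q. claim_walk \<delta> (d q) (z q) x n) \<in> borel_measurable Q"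
  shows "(\<lambda>q. survival \<delta> (d q) (z q) x N) \<in> borel_measurable Q"
  using assms
proof (induction N)
  case 0
  then show ?case by (simp add: survival_def)
next
  case (Suc N)
  have [measurable]: "(\<lambda>q. claim_walk \<delta> (d q) (z q) x (Suc N)) \<in> borel_measurable Q"
    "(\<lambda>q. survival \<delta> (d q) (z q) x N) \<in> borel_measurable Q"
    using Suc by auto
  show ?case unfolding survival_Suc by measurable
qed

text \<open>
One step of the walk, where \<open>p\<close> is the law of the number of claims in a step and \<open>\<mu> j\<close> is the law of the
sum of \<open>j\<close> claims; paths that become negative are killed.
\<close>

definition step_operator ::
    "real \<Rightarrow> nat measure \<Rightarrow> (nat \<Rightarrow> real measure) \<Rightarrow> (real \<Rightarrow> ennreal) \<Rightarrow> real \<Rightarrow> ennreal" where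
  "step_operator \<delta> p \<mu> g x =
    (\<integral>\<^sup>+j. \<integral>\<^sup>+s. g (x + \<delta> - s) * indicator {0..} (x + \<delta> - s) \<partial>\<mu> j \<partial>p)"

text \<open>
Only the laws of sums over blocks of consecutive claims enter the argument, so identical distribution
is expressed by their invariance under translation of the block.
\<close>

locale iid_claims = prob_space P for P :: "'a measure" +
  fixes Z :: "nat \<Rightarrow> 'a \<Rightarrow> real" and \<mu> :: "nat \<Rightarrow> real measure"
  assumes indep_Z: "indep_vars (\<lambda>_. borel) Z {1..}"
    and block_law: "\<And>m j. distr P borel (\<lambda>\<omega>. \<Sum>i\<in>{m<..m + j}. Z i \<omega>) = \<mu> j"
begin

lemma measurable_Z [measurable]: "1 \<le> i \<Longrightarrow> Z i \<in> borel_measurable P"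
  using indep_Z by (auto simp: indep_vars_def)

lemma measurable_block: "(\<lambda>\<omega>. \<Sum>i\<in>{m<..m + j}. Z i \<omega>) \<in> borel_measurable P"
  by (intro borel_measurable_sum measurable_Z) auto

lemma sets_block_law [measurable_cong]: "sets (\<mu> j) = sets borel"
  unfolding block_law[of 0 j, symmetric] by simp

lemma prob_space_block_law: "prob_space (\<mu> j)"
  unfolding block_law[of 0 j, symmetric] by (rule prob_space_distr) (rule measurable_block)

lemma block_law_0: "\<mu> 0 = return borel 0"
  unfolding block_law[of 0 0, symmetric] by (simp add: distr_const)

lemma measurable_step_operator [measurable]:
  assumes [measurable]: "g \<in> borel_measurable borel" and p: "prob_space p" "sets p = sets (count_space UNIV)"
  shows "step_operator \<delta> p \<mu> g \<in> borel_measurable borel"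
proof -
  interpret p: prob_space p by fact
  have "(\<lambda>q. (\<lambda>j q. \<integral>\<^sup>+s. g (fst q + \<delta> - s) * indicator {0..} (fst q + \<delta> - s) \<partial>\<mu> j) (snd q) q)
      \<in> borel_measurable (borel \<Otimes>\<^sub>M p)"
  proof (rule measurable_compose_countable)
    fix j
    interpret \<mu>: prob_space "\<mu> j" by (rule prob_space_block_law)
    show "(\<lambda>q. \<integral>\<^sup>+s. g (fst q + \<delta> - s) * indicator {0..} (fst q + \<delta> - s) \<partial>\<mu> j) \<in> borel_measurable (borel \<Otimes>\<^sub>M p)"
      by measurable
    show "snd \<in> measurable (borel \<Otimes>\<^sub>M p) (count_space UNIV)"
      using measurable_snd[of borel p] by (simp add: measurable_cong_sets[OF refl p(2)])
  qed
  then show ?thesis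
    unfolding step_operator_def[abs_def]
    by (intro p.borel_measurable_nn_integral) (simp add: case_prod_beta)
qed

definition survival_mean where
  "survival_mean \<delta> d g x N =
    (\<integral>\<^sup>+\<omega>. g (claim_walk \<delta> d (\<lambda>i. Z i \<omega>) x N) * survival \<delta> d (\<lambda>i. Z i \<omega>) x N \<partial>P)"

text \<open>
For fixed claim numbers, the claims consumed in the last step are independent of those that determine
the earlier values of the walk. Integrating them out first replaces \<open>g\<close> by its mean after one step.
\<close>

lemma survival_mean_Suc:
  assumes [measurable]: "g \<in> borel_measurable borel"
  shows "survival_mean \<delta> d g x (Suc N) =
    survival_mean \<delta> d (\<lambda>y. \<integral>\<^sup>+s. g (y + \<delta> - s) * indicator {0..} (y + \<delta> - s) \<partial>\<mu> (d N)) x N"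
proof -
  define m where "m = (\<Sum>l<N. d l)"
  define A where "A = {1..m}"
  define B where "B = {m<..m + d N}"
  define X where "X \<omega> = restrict (\<lambda>i. Z i \<omega>) A" for \<omega>
  define Y where "Y \<omega> = restrict (\<lambda>i. Z i \<omega>) B" for \<omega>
  let ?N = "PiM A (\<lambda>_. borel :: real measure)" and ?B = "PiM B (\<lambda>_. borel :: real measure)"
  define H where "H q = (case q of (z, s) \<Rightarrow> g (claim_walk \<delta> d z x N + \<delta> - s) *
    indicator {0..} (claim_walk \<delta> d z x N + \<delta> - s) * survival \<delta> d z x N)" for q
  interpret \<mu>: prob_space "\<mu> (d N)" by (rule prob_space_block_law)
  have ind: "indep_var ?N X ?B Y"
    unfolding X_def Y_def
    by (rule indep_var_restrict[OF indep_Z]) (auto simp: A_def B_def)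
  have rv [measurable]: "X \<in> measurable P ?N" "Y \<in> measurable P ?B"
    using indep_var_rv1[OF ind] indep_var_rv2[OF ind] by auto
  have law: "distr P (?N \<Otimes>\<^sub>M ?B) (\<lambda>\<omega>. (X \<omega>, Y \<omega>)) = distr P ?N X \<Otimes>\<^sub>M distr P ?B Y"
    using ind unfolding indep_var_distribution_eq by simp
  have sumB [measurable]: "(\<lambda>y. \<Sum>i\<in>B. y i) \<in> borel_measurable ?B"
    by (intro borel_measurable_sum measurable_component_singleton)
  have law_Y: "distr (distr P ?B Y) borel (\<lambda>y. \<Sum>i\<in>B. y i) = \<mu> (d N)"
  proof -
    have "distr (distr P ?B Y) borel (\<lambda>y. \<Sum>i\<in>B. y i) = distr P borel (\<lambda>\<omega>. \<Sum>i\<in>B. Y \<omega> i)"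
      by (subst distr_distr) (auto simp: comp_def)
    also have "\<dots> = distr P borel (\<lambda>\<omega>. \<Sum>i\<in>B. Z i \<omega>)" by (simp add: Y_def)
    finally show ?thesis by (simp add: B_def block_law)
  qed
  interpret Y: prob_space "distr P ?B Y" by (rule prob_space_distr) (rule rv)
  have walk_X: "claim_walk \<delta> d (\<lambda>i. Z i \<omega>) x n = claim_walk \<delta> d (X \<omega>) x n" if "n \<le> N" for n \<omega>
  proof (rule claim_walk_cong)
    have "(\<Sum>l<n. d l) \<le> m" unfolding m_def using that by (intro sum_mono2) auto
    then show "Z i \<omega> = X \<omega> i" if "1 \<le> i" "i \<le> (\<Sum>l<n. d l)" for i
      using that by (simp add: X_def A_def)
  qed simp
  have surv_X: "survival \<delta> d (\<lambda>i. Z i \<omega>) x N = survival \<delta> d (X \<omega>) x N" for \<omega>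
    by (rule survival_cong) (auto simp: X_def A_def m_def)
  have meas_walk: "(\<lambda>z. claim_walk \<delta> d z x n) \<in> borel_measurable ?N" if "n \<le> N" for n
  proof -
    have "(\<Sum>l<n. d l) \<le> m" unfolding m_def using that by (intro sum_mono2) auto
    then have "(\<lambda>z. \<Sum>i = 1..(\<Sum>l<n. d l). z i) \<in> borel_measurable ?N"
      by (intro borel_measurable_sum measurable_component_singleton) (auto simp: A_def)
    then show ?thesis unfolding claim_walk_def by simp
  qed
  have [measurable]: "(\<lambda>z. claim_walk \<delta> d z x N) \<in> borel_measurable ?N"
    "(\<lambda>z. survival \<delta> d z x N) \<in> borel_measurable ?N"
    using meas_walk by (auto intro!: measurable_survival)
  have [measurable]: "H \<in> borel_measurable (?N \<Otimes>\<^sub>M borel)"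
    unfolding H_def[abs_def] by measurable
  let ?H = "\<lambda>q. H (fst q, \<Sum>i\<in>B. snd q i)"
  have "survival_mean \<delta> d g x (Suc N) = (\<integral>\<^sup>+\<omega>. ?H (X \<omega>, Y \<omega>) \<partial>P)"
    unfolding survival_mean_def survival_Suc claim_walk_Suc m_def[symmetric] B_def[symmetric]
    by (simp add: walk_X surv_X H_def Y_def mult_ac)
  also have "\<dots> = (\<integral>\<^sup>+q. ?H q \<partial>distr P (?N \<Otimes>\<^sub>M ?B) (\<lambda>\<omega>. (X \<omega>, Y \<omega>)))"
    by (subst nn_integral_distr) auto
  also have "\<dots> = (\<integral>\<^sup>+z. \<integral>\<^sup>+y. ?H (z, y) \<partial>distr P ?B Y \<partial>distr P ?N X)"
    unfolding law by (rule Y.nn_integral_fst[symmetric]) measurable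
  also have "\<dots> = (\<integral>\<^sup>+z. \<integral>\<^sup>+s. H (z, s) \<partial>\<mu> (d N) \<partial>distr P ?N X)"
  proof (rule nn_integral_cong)
    fix z assume "z \<in> space (distr P ?N X)"
    then have [measurable]: "z \<in> space ?N" by simp
    show "(\<integral>\<^sup>+y. ?H (z, y) \<partial>distr P ?B Y) = (\<integral>\<^sup>+s. H (z, s) \<partial>\<mu> (d N))"
      unfolding law_Y[symmetric] by (subst nn_integral_distr) auto
  qed
  also have "\<dots> = (\<integral>\<^sup>+\<omega>. \<integral>\<^sup>+s. H (X \<omega>, s) \<partial>\<mu> (d N) \<partial>P)"
    by (subst nn_integral_distr) auto
  also have "\<dots> = survival_mean \<delta> d (\<lambda>y. \<integral>\<^sup>+s. g (y + \<delta> - s) * indicator {0..} (y + \<delta> - s) \<partial>\<mu> (d N)) x N"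
    unfolding survival_mean_def H_def
    by (simp add: walk_X surv_X) (intro nn_integral_cong nn_integral_multc; measurable)
  finally show ?thesis .
qed

lemma survival_mean_cong:
  "(\<And>l. l < N \<Longrightarrow> d l = d' l) \<Longrightarrow> survival_mean \<delta> d g x N = survival_mean \<delta> d' g x N"
  unfolding survival_mean_def
  by (intro nn_integral_cong arg_cong2[where f = "(*)"] arg_cong[where f = g] claim_walk_cong survival_cong) auto

lemma measurable_claim_walk_pair:
  assumes "n \<le> N" "\<And>l. sets (p l) = sets (count_space UNIV)"
  shows "(\<lambda>(d, \<omega>). claim_walk \<delta> d (\<lambda>i. Z i \<omega>) x n) \<in> borel_measurable (PiM {..<N} p \<Otimes>\<^sub>M P)"
  unfolding case_prod_beta
proof (rule measurable_claim_walk)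
  fix l assume "l < n"
  then have "(\<lambda>d. d l) \<in> measurable (PiM {..<N} p) (p l)"
    using assms(1) by (intro measurable_component_singleton) auto
  then have "(\<lambda>d. d l) \<in> measurable (PiM {..<N} p) (count_space UNIV)"
    by (simp add: measurable_cong_sets[OF refl assms(2)])
  then show "(\<lambda>q. fst q l) \<in> measurable (PiM {..<N} p \<Otimes>\<^sub>M P) (count_space UNIV)"
    by (rule measurable_compose[OF measurable_fst])
qed (rule measurable_compose[OF measurable_snd measurable_Z])

lemma measurable_survival_pair:
  assumes "\<And>l. sets (p l) = sets (count_space UNIV)"
  shows "(\<lambda>(d, \<omega>). survival \<delta> d (\<lambda>i. Z i \<omega>) x N) \<in> borel_measurable (PiM {..<N} p \<Otimes>\<^sub>M P)"
  using measurable_claim_walk_pair[OF _ assms, where N = N and \<delta> = \<delta> and x = x]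
  unfolding case_prod_beta by (intro measurable_survival) auto

lemma measurable_survival_mean:
  assumes [measurable]: "g \<in> borel_measurable borel" and p: "\<And>l. sets (p l) = sets (count_space UNIV)"
  shows "(\<lambda>d. survival_mean \<delta> d g x N) \<in> borel_measurable (PiM {..<N} p)"
proof -
  note [measurable] = measurable_survival_pair[OF p, where \<delta> = \<delta> and x = x and N = N]
    measurable_claim_walk_pair[OF order_refl p, where \<delta> = \<delta> and x = x and N = N]
  show ?thesis unfolding survival_mean_def[abs_def]
  proof (rule borel_measurable_nn_integral)
    have "(\<lambda>q. g ((\<lambda>(d, \<omega>). claim_walk \<delta> d (\<lambda>i. Z i \<omega>) x N) q) * (\<lambda>(d, \<omega>). survival \<delta> d (\<lambda>i. Z i \<omega>) x N) q)
        \<in> borel_measurable (PiM {..<N} p \<Otimes>\<^sub>M P)"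
      by measurable
    then show "(\<lambda>(d, \<omega>). g (claim_walk \<delta> d (\<lambda>i. Z i \<omega>) x N) * survival \<delta> d (\<lambda>i. Z i \<omega>) x N)
        \<in> borel_measurable (PiM {..<N} p \<Otimes>\<^sub>M P)"
      by (simp add: case_prod_beta)
  qed
qed

text \<open>
Averaging over the claim numbers as well turns one more step of the walk into one more application of
the step operator. The induction peels off the last step, so that no law of a shifted claim
sequence is needed.
\<close>

lemma survival_mean_mixture:
  assumes p: "prob_space p" "sets p = sets (count_space UNIV)" and "g \<in> borel_measurable borel"
  shows "(\<integral>\<^sup>+d. survival_mean \<delta> d g x N \<partial>PiM {..<N} (\<lambda>_. p)) = (step_operator \<delta> p \<mu> ^^ N) g x"
  using assms(3)
proof (induction N arbitrary: g)
  case 0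
  show ?case by (simp add: survival_mean_def claim_walk_def survival_def PiM_empty emeasure_space_1)
next
  case (Suc N)
  note [measurable] = Suc.prems
  interpret p: prob_space p by fact
  interpret pp: product_sigma_finite "\<lambda>_::nat. p" ..
  interpret Pp: pair_sigma_finite p P ..
  have ins: "{..<Suc N} = insert N {..<N}" by auto
  define K where "K j y = (\<integral>\<^sup>+s. g (y + \<delta> - s) * indicator {0..} (y + \<delta> - s) \<partial>\<mu> j)" for j y
  have [measurable]: "K j \<in> borel_measurable borel" for j
  proof -
    interpret \<mu>: prob_space "\<mu> j" by (rule prob_space_block_law)
    show ?thesis unfolding K_def[abs_def] by measurable
  qed
  have "(\<integral>\<^sup>+d. survival_mean \<delta> d g x (Suc N) \<partial>PiM {..<Suc N} (\<lambda>_. p)) =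
      (\<integral>\<^sup>+d. \<integral>\<^sup>+j. survival_mean \<delta> (d(N := j)) g x (Suc N) \<partial>p \<partial>PiM {..<N} (\<lambda>_. p))"
    using measurable_survival_mean[where g = g and p = "\<lambda>_. p" and \<delta> = \<delta> and x = x and N = "Suc N"] p(2) unfolding ins
    by (intro pp.product_nn_integral_insert) auto
  also have "\<dots> = (\<integral>\<^sup>+d. \<integral>\<^sup>+j. survival_mean \<delta> d (K j) x N \<partial>p \<partial>PiM {..<N} (\<lambda>_. p))"
  proof (intro nn_integral_cong)
    fix d j
    show "survival_mean \<delta> (d(N := j)) g x (Suc N) = survival_mean \<delta> d (K j) x N"
      by (subst survival_mean_Suc) (auto simp: K_def[abs_def] intro!: survival_mean_cong)
  qed
  also have "\<dots> = (\<integral>\<^sup>+d. survival_mean \<delta> d (step_operator \<delta> p \<mu> g) x N \<partial>PiM {..<N} (\<lambda>_. p))"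
  proof (intro nn_integral_cong)
    fix d :: "nat \<Rightarrow> nat"
    have walk [measurable]: "(\<lambda>\<omega>. claim_walk \<delta> d (\<lambda>i. Z i \<omega>) x n) \<in> borel_measurable P" for n
      by (rule measurable_claim_walk) auto
    have [measurable]: "(\<lambda>\<omega>. survival \<delta> d (\<lambda>i. Z i \<omega>) x N) \<in> borel_measurable P"
      by (rule measurable_survival) (rule walk)
    have fst_p: "fst \<in> measurable (p \<Otimes>\<^sub>M P) (count_space UNIV)"
      using measurable_fst[of p P] by (simp add: measurable_cong_sets[OF refl p(2)])
    have "(\<lambda>q. (\<lambda>j q. K j (claim_walk \<delta> d (\<lambda>i. Z i (snd q)) x N) * survival \<delta> d (\<lambda>i. Z i (snd q)) x N) (fst q) q)
        \<in> borel_measurable (p \<Otimes>\<^sub>M P)"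
      by (rule measurable_compose_countable[OF _ fst_p]) measurable
    then have m: "(\<lambda>(j, \<omega>). K j (claim_walk \<delta> d (\<lambda>i. Z i \<omega>) x N) * survival \<delta> d (\<lambda>i. Z i \<omega>) x N)
        \<in> borel_measurable (p \<Otimes>\<^sub>M P)"
      by (simp add: case_prod_beta)
    have "(\<integral>\<^sup>+j. survival_mean \<delta> d (K j) x N \<partial>p) =
        (\<integral>\<^sup>+\<omega>. \<integral>\<^sup>+j. K j (claim_walk \<delta> d (\<lambda>i. Z i \<omega>) x N) * survival \<delta> d (\<lambda>i. Z i \<omega>) x N \<partial>p \<partial>P)"
      unfolding survival_mean_def by (rule Pp.Fubini'[OF m, symmetric])
    also have "\<dots> = survival_mean \<delta> d (step_operator \<delta> p \<mu> g) x N"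
      unfolding survival_mean_def step_operator_def K_def[symmetric]
    proof (intro nn_integral_cong nn_integral_multc)
      show "(\<lambda>j. K j y) \<in> borel_measurable p" for y
        by (simp add: measurable_cong_sets[OF p(2) refl])
    qed
    finally show "(\<integral>\<^sup>+j. survival_mean \<delta> d (K j) x N \<partial>p) = survival_mean \<delta> d (step_operator \<delta> p \<mu> g) x N" .
  qed
  also have "\<dots> = (step_operator \<delta> p \<mu> ^^ N) (step_operator \<delta> p \<mu> g) x"
    by (rule Suc.IH) (rule measurable_step_operator[OF Suc.prems p])
  finally show ?case by (simp add: funpow_swap1)
qed

text \<open>
The law of the claim numbers is a product measure, and it is independent of the claims; Fubini's
theorem reduces the claim to the average over fixed claim numbers.
\<close>

theorem survival_eq_step_operator:
  assumes p: "sets p = sets (count_space UNIV)"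
    and D: "indep_vars (\<lambda>_. count_space UNIV) D {..<N}" "\<And>l. l < N \<Longrightarrow> distr P (count_space UNIV) (D l) = p"
    and p1: "prob_space p"
    and ind: "distr P (PiM {..<N} (\<lambda>_. count_space UNIV) \<Otimes>\<^sub>M PiM {1..} (\<lambda>_. borel))
        (\<lambda>\<omega>. (\<lambda>l\<in>{..<N}. D l \<omega>, \<lambda>i\<in>{1..}. Z i \<omega>)) =
      distr P (PiM {..<N} (\<lambda>_. count_space UNIV)) (\<lambda>\<omega>. \<lambda>l\<in>{..<N}. D l \<omega>) \<Otimes>\<^sub>M
      distr P (PiM {1..} (\<lambda>_. borel)) (\<lambda>\<omega>. \<lambda>i\<in>{1..}. Z i \<omega>)"
  shows "(\<integral>\<^sup>+\<omega>. survival \<delta> (\<lambda>l. D l \<omega>) (\<lambda>i. Z i \<omega>) x N \<partial>P) = (step_operator \<delta> p \<mu> ^^ N) (\<lambda>_. 1) x"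
proof (cases "N = 0")
  case True
  then show ?thesis by (simp add: survival_def emeasure_space_1)
next
  case False
  let ?C = "PiM {..<N} (\<lambda>_. count_space UNIV :: nat measure)"
  let ?B = "PiM {1..} (\<lambda>_. borel :: real measure)"
  let ?D = "\<lambda>\<omega>. \<lambda>l\<in>{..<N}. D l \<omega>" and ?Z = "\<lambda>\<omega>. \<lambda>i\<in>{1..}. Z i \<omega>"
  have rv [measurable]: "?D \<in> measurable P ?C" "?Z \<in> measurable P ?B"
    using D(1) by (auto simp: indep_vars_def intro!: measurable_restrict)
  interpret zz: prob_space "distr P ?B ?Z" by (rule prob_space_distr) (rule rv)
  have law_D: "distr P ?C ?D = PiM {..<N} (\<lambda>_. p)"
  proof -
    have "distr P ?C ?D = PiM {..<N} (\<lambda>l. distr P (count_space UNIV) (D l))"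
      using indep_vars_iff_distr_eq_PiM'[where I = "{..<N}" and M' = "\<lambda>_. count_space UNIV" and X = D]
        D(1) False
      by (auto simp: indep_vars_def)
    also have "\<dots> = PiM {..<N} (\<lambda>_. p)" using D(2) by (intro PiM_cong) auto
    finally show ?thesis .
  qed
  have walk: "(\<lambda>q. claim_walk \<delta> (fst q) (snd q) x n) \<in> borel_measurable (?C \<Otimes>\<^sub>M ?B)" if "n \<le> N" for n
  proof (rule measurable_claim_walk)
    fix l assume "l < n"
    then show "(\<lambda>q. fst q l) \<in> measurable (?C \<Otimes>\<^sub>M ?B) (count_space UNIV)"
      using that by (intro measurable_compose[OF measurable_fst measurable_component_singleton]) auto
  next
    fix i :: nat assume "1 \<le> i"
    then show "(\<lambda>q. snd q i) \<in> borel_measurable (?C \<Otimes>\<^sub>M ?B)"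
      by (intro measurable_compose[OF measurable_snd measurable_component_singleton]) auto
  qed
  have [measurable]: "(\<lambda>q. survival \<delta> (fst q) (snd q) x N) \<in> borel_measurable (?C \<Otimes>\<^sub>M ?B)"
  proof (rule measurable_survival)
    fix n assume "n \<in> {1..N}"
    then have "n \<le> N" by simp
    then show "(\<lambda>q. claim_walk \<delta> (fst q) (snd q) x n) \<in> borel_measurable (?C \<Otimes>\<^sub>M ?B)"
      by (rule walk)
  qed
  have "(\<integral>\<^sup>+\<omega>. survival \<delta> (\<lambda>l. D l \<omega>) (\<lambda>i. Z i \<omega>) x N \<partial>P) =
      (\<integral>\<^sup>+\<omega>. survival \<delta> (fst (?D \<omega>, ?Z \<omega>)) (snd (?D \<omega>, ?Z \<omega>)) x N \<partial>P)"
    by (intro nn_integral_cong survival_cong) auto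
  also have "\<dots> = (\<integral>\<^sup>+q. survival \<delta> (fst q) (snd q) x N \<partial>distr P (?C \<Otimes>\<^sub>M ?B) (\<lambda>\<omega>. (?D \<omega>, ?Z \<omega>)))"
    by (subst nn_integral_distr) (auto simp del: One_nat_def)
  also have "distr P (?C \<Otimes>\<^sub>M ?B) (\<lambda>\<omega>. (?D \<omega>, ?Z \<omega>)) = distr P ?C ?D \<Otimes>\<^sub>M distr P ?B ?Z"
    by (rule ind)
  also have "(\<integral>\<^sup>+q. survival \<delta> (fst q) (snd q) x N \<partial>(distr P ?C ?D \<Otimes>\<^sub>M distr P ?B ?Z)) =
      (\<integral>\<^sup>+d. \<integral>\<^sup>+z. survival \<delta> (fst (d, z)) (snd (d, z)) x N \<partial>distr P ?B ?Z \<partial>distr P ?C ?D)"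
    by (rule zz.nn_integral_fst[symmetric]) measurable
  also have "\<dots> = (\<integral>\<^sup>+d. \<integral>\<^sup>+z. survival \<delta> (fst (d, z)) (snd (d, z)) x N \<partial>distr P ?B ?Z \<partial>PiM {..<N} (\<lambda>_. p))"
    unfolding law_D ..
  also have "\<dots> = (\<integral>\<^sup>+d. survival_mean \<delta> d (\<lambda>_. 1) x N \<partial>PiM {..<N} (\<lambda>_. p))"
  proof (rule nn_integral_cong)
    fix d assume "d \<in> space (PiM {..<N} (\<lambda>_. p))"
    then have d: "d \<in> space ?C"
      using sets_eq_imp_space_eq[OF p] by (simp add: space_PiM)
    have "(\<lambda>z. survival \<delta> (fst (d, z)) (snd (d, z)) x N) \<in> borel_measurable ?B"
      using d by measurable
    then have "(\<integral>\<^sup>+z. survival \<delta> (fst (d, z)) (snd (d, z)) x N \<partial>distr P ?B ?Z) =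
        (\<integral>\<^sup>+\<omega>. survival \<delta> d (?Z \<omega>) x N \<partial>P)"
      by (subst nn_integral_distr) (auto simp del: One_nat_def)
    also have "\<dots> = survival_mean \<delta> d (\<lambda>_. 1) x N"
      unfolding survival_mean_def by (intro nn_integral_cong) (auto intro!: survival_cong)
    finally show "(\<integral>\<^sup>+z. survival \<delta> (fst (d, z)) (snd (d, z)) x N \<partial>distr P ?B ?Z) =
      survival_mean \<delta> d (\<lambda>_. 1) x N" .
  qed
  also have "\<dots> = (step_operator \<delta> p \<mu> ^^ N) (\<lambda>_. 1) x"
    by (rule survival_mean_mixture[OF p1 p]) simp
  finally show ?thesis .
qed

text \<open>
The probability of surviving \<open>N + 1\<close> steps is the step operator applied to the probability of surviving
\<open>N\<close> steps. Both sides pass to the limit of infinitely many steps by dominated convergence.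
\<close>

theorem never_ruined_fixed_point:
  fixes D :: "nat \<Rightarrow> 'a \<Rightarrow> nat" and \<delta> :: real
  defines "f \<equiv> \<lambda>x. if x < 0 then 0 else
    prob {\<omega> \<in> space P. \<forall>n\<ge>1. 0 \<le> claim_walk \<delta> (\<lambda>l. D l \<omega>) (\<lambda>i. Z i \<omega>) x n}"
  assumes p: "prob_space p" "sets p = sets (count_space UNIV)"
    and D: "\<And>N. indep_vars (\<lambda>_. count_space UNIV) D {..<N}" "\<And>l. distr P (count_space UNIV) (D l) = p"
    and ind: "\<And>N. distr P (PiM {..<N} (\<lambda>_. count_space UNIV) \<Otimes>\<^sub>M PiM {1..} (\<lambda>_. borel))
        (\<lambda>\<omega>. (\<lambda>l\<in>{..<N}. D l \<omega>, \<lambda>i\<in>{1..}. Z i \<omega>)) =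
      distr P (PiM {..<N} (\<lambda>_. count_space UNIV)) (\<lambda>\<omega>. \<lambda>l\<in>{..<N}. D l \<omega>) \<Otimes>\<^sub>M
      distr P (PiM {1..} (\<lambda>_. borel)) (\<lambda>\<omega>. \<lambda>i\<in>{1..}. Z i \<omega>)"
  shows "mono f" and "0 \<le> x \<Longrightarrow> f x = (\<integral>j. \<integral>s. f (x + \<delta> - s) \<partial>\<mu> j \<partial>p)"
proof -
  interpret p: prob_space p by fact
  have [measurable]: "D l \<in> measurable P (count_space UNIV)" for l
    using D(1)[of "Suc l"] by (auto simp: indep_vars_def)
  have walk [measurable]: "(\<lambda>\<omega>. claim_walk \<delta> (\<lambda>l. D l \<omega>) (\<lambda>i. Z i \<omega>) x n) \<in> borel_measurable P" for x n
    by (rule measurable_claim_walk) auto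
  have walk_mono: "claim_walk \<delta> d z x n \<le> claim_walk \<delta> d z y n" if "x \<le> y" for x y d z n
    using that by (simp add: claim_walk_def)
  define A where "A N x = {\<omega> \<in> space P. \<forall>n\<in>{1..N}. 0 \<le> claim_walk \<delta> (\<lambda>l. D l \<omega>) (\<lambda>i. Z i \<omega>) x n}" for N x
  have A_meas [measurable]: "A N x \<in> sets P" for N x unfolding A_def by measurable
  define fN where "fN N x = (if x < 0 then 0 else prob (A N x))" for N x
  have fN: "0 \<le> fN N x" "fN N x \<le> 1" for N x by (simp_all add: fN_def)
  have mono_fN: "mono (fN N)" for N
  proof (rule monoI)
    fix x y :: real assume "x \<le> y"
    moreover have "prob (A N x) \<le> prob (A N y)" if "x \<le> y"
      using walk_mono[OF that] by (intro finite_measure_mono A_meas) (auto simp: A_def intro: order.trans)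
    ultimately show "fN N x \<le> fN N y" by (auto simp: fN_def)
  qed
  have [measurable]: "fN N \<in> borel_measurable borel" for N
    using mono_fN by (rule borel_measurable_mono)
  have A_step: "ennreal (prob (A N x)) = (step_operator \<delta> p \<mu> ^^ N) (\<lambda>_. 1) x" for N x
  proof -
    have "ennreal (prob (A N x)) = (\<integral>\<^sup>+\<omega>. indicator (A N x) \<omega> \<partial>P)"
      by (simp add: emeasure_eq_measure)
    also have "\<dots> = (\<integral>\<^sup>+\<omega>. survival \<delta> (\<lambda>l. D l \<omega>) (\<lambda>i. Z i \<omega>) x N \<partial>P)"
      by (intro nn_integral_cong) (auto simp: A_def survival_def)
    also have "\<dots> = (step_operator \<delta> p \<mu> ^^ N) (\<lambda>_. 1) x"
      by (rule survival_eq_step_operator[OF p(2) D(1,2) p(1) ind])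
    finally show ?thesis .
  qed
  have fN_Suc: "fN (Suc N) x = (\<integral>j. \<integral>s. fN N (x + \<delta> - s) \<partial>\<mu> j \<partial>p)" if "0 \<le> x" for N x
  proof -
    have inner: "0 \<le> (\<integral>s. fN N (x + \<delta> - s) \<partial>\<mu> j)" "(\<integral>s. fN N (x + \<delta> - s) \<partial>\<mu> j) \<le> 1" for j
    proof -
      interpret \<mu>: prob_space "\<mu> j" by (rule prob_space_block_law)
      show "0 \<le> (\<integral>s. fN N (x + \<delta> - s) \<partial>\<mu> j)" using fN by simp
      show "(\<integral>s. fN N (x + \<delta> - s) \<partial>\<mu> j) \<le> 1"
        using fN by (intro \<mu>.integral_le_const \<mu>.integrable_const_bound[where B = 1]) auto
    qed
    have "ennreal (fN (Suc N) x) = step_operator \<delta> p \<mu> ((step_operator \<delta> p \<mu> ^^ N) (\<lambda>_. 1)) x"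
      using that by (simp add: fN_def A_step)
    also have "\<dots> = (\<integral>\<^sup>+j. \<integral>\<^sup>+s. ennreal (fN N (x + \<delta> - s)) \<partial>\<mu> j \<partial>p)"
      unfolding step_operator_def[of _ _ _ "(step_operator \<delta> p \<mu> ^^ N) (\<lambda>_. 1)"] A_step[symmetric]
      by (intro nn_integral_cong) (auto simp: fN_def indicator_def)
    also have "\<dots> = (\<integral>\<^sup>+j. ennreal (\<integral>s. fN N (x + \<delta> - s) \<partial>\<mu> j) \<partial>p)"
    proof (rule nn_integral_cong)
      fix j
      interpret \<mu>: prob_space "\<mu> j" by (rule prob_space_block_law)
      show "(\<integral>\<^sup>+s. ennreal (fN N (x + \<delta> - s)) \<partial>\<mu> j) = ennreal (\<integral>s. fN N (x + \<delta> - s) \<partial>\<mu> j)"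
        using fN by (intro nn_integral_eq_integral \<mu>.integrable_const_bound[where B = 1]) auto
    qed
    also have "\<dots> = ennreal (\<integral>j. \<integral>s. fN N (x + \<delta> - s) \<partial>\<mu> j \<partial>p)"
      using inner
      by (intro nn_integral_eq_integral p.integrable_const_bound[where B = 1])
        (auto simp: measurable_cong_sets[OF p(2) refl])
    finally show ?thesis
      using fN inner by (subst (asm) ennreal_inj) auto
  qed
  have lim: "(\<lambda>N. fN N x) \<longlonglongrightarrow> f x" for x
  proof (cases "x < 0")
    case False
    have "(\<lambda>N. prob (A N x)) \<longlonglongrightarrow> prob (\<Inter>N. A N x)"
      by (rule finite_Lim_measure_decseq) (auto simp: decseq_def A_def)
    also have "(\<Inter>N. A N x) = {\<omega> \<in> space P. \<forall>n\<ge>1. 0 \<le> claim_walk \<delta> (\<lambda>l. D l \<omega>) (\<lambda>i. Z i \<omega>) x n}"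
    proof -
      have "(\<forall>N. \<forall>n\<in>{1..N}. Q n) \<longleftrightarrow> (\<forall>n\<ge>1. Q n)" for Q :: "nat \<Rightarrow> bool"
        by (meson atLeastAtMost_iff order_refl)
      then show ?thesis by (simp add: A_def set_eq_iff)
    qed
    finally show ?thesis using False by (simp add: f_def fN_def)
  qed (simp add: f_def fN_def)
  show "mono f"
  proof (rule monoI)
    fix x y :: real assume "x \<le> y"
    then show "f x \<le> f y"
      using mono_fN by (intro LIMSEQ_le[OF lim lim]) (auto dest: monoD)
  qed
  then have [measurable]: "f \<in> borel_measurable borel" by (rule borel_measurable_mono)
  show "f x = (\<integral>j. \<integral>s. f (x + \<delta> - s) \<partial>\<mu> j \<partial>p)" if x: "0 \<le> x"
  proof -
    have inner: "(\<lambda>N. \<integral>s. fN N (x + \<delta> - s) \<partial>\<mu> j) \<longlonglongrightarrow> (\<integral>s. f (x + \<delta> - s) \<partial>\<mu> j)" for j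
    proof -
      interpret \<mu>: prob_space "\<mu> j" by (rule prob_space_block_law)
      show ?thesis
      proof (rule integral_dominated_convergence[where w = "\<lambda>_. 1"])
        show "AE s in \<mu> j. (\<lambda>N. fN N (x + \<delta> - s)) \<longlonglongrightarrow> f (x + \<delta> - s)"
          by (intro AE_I2 lim)
      qed (use fN in auto)
    qed
    have "(\<lambda>N. \<integral>j. \<integral>s. fN N (x + \<delta> - s) \<partial>\<mu> j \<partial>p) \<longlonglongrightarrow> (\<integral>j. \<integral>s. f (x + \<delta> - s) \<partial>\<mu> j \<partial>p)"
    proof (rule integral_dominated_convergence[where w = "\<lambda>_. 1"])
      show "AE j in p. (\<lambda>N. \<integral>s. fN N (x + \<delta> - s) \<partial>\<mu> j) \<longlonglongrightarrow> (\<integral>s. f (x + \<delta> - s) \<partial>\<mu> j)"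
        by (intro AE_I2 inner)
      show "AE j in p. norm (\<integral>s. fN N (x + \<delta> - s) \<partial>\<mu> j) \<le> 1" for N
      proof (rule AE_I2)
        fix j
        interpret \<mu>: prob_space "\<mu> j" by (rule prob_space_block_law)
        have "(\<integral>s. fN N (x + \<delta> - s) \<partial>\<mu> j) \<le> 1"
          using fN by (intro \<mu>.integral_le_const \<mu>.integrable_const_bound[where B = 1]) auto
        moreover have "0 \<le> (\<integral>s. fN N (x + \<delta> - s) \<partial>\<mu> j)" using fN by simp
        ultimately show "norm (\<integral>s. fN N (x + \<delta> - s) \<partial>\<mu> j) \<le> 1" by simp
      qed
    qed (auto simp: measurable_cong_sets[OF p(2) refl])
    moreover have "(\<lambda>N. \<integral>j. \<integral>s. fN N (x + \<delta> - s) \<partial>\<mu> j \<partial>p) \<longlonglongrightarrow> f x"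
      using LIMSEQ_Suc[OF lim[of x]] by (simp add: fN_Suc[OF x])
    ultimately show ?thesis by (rule LIMSEQ_unique[rotated])
  qed
qed

end

section \<open>From a fine time skeleton to continuous time\<close>

lemma prob_integral_unit_interval:
  fixes f :: "'a \<Rightarrow> real"
  assumes "prob_space N" "\<And>x. 0 \<le> f x" "\<And>x. f x \<le> 1"
  shows "0 \<le> (\<integral>x. f x \<partial>N)" and "(\<integral>x. f x \<partial>N) \<le> 1"
proof -
  interpret prob_space N by fact
  show "0 \<le> (\<integral>x. f x \<partial>N)" using assms by simp
  show "(\<integral>x. f x \<partial>N) \<le> 1"
  proof (cases "integrable N f")
    case True
    then show ?thesis using assms by (intro integral_le_const) auto
  qed (simp add: not_integrable_integral_eq)
qed

text \<open>
Used for the number of claims in a short time: values up to \<open>k\<close> are kept, and everything beyond has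
negligible probability.
\<close>

lemma integral_nat_split:
  fixes G :: "nat \<Rightarrow> real"
  assumes p: "prob_space p" and sets_p: "sets p = UNIV" and G: "\<And>j. 0 \<le> G j" "\<And>j. G j \<le> 1"
  shows "\<exists>R. 0 \<le> R \<and> R \<le> measure p {k<..} \<and>
    (\<integral>j. G j \<partial>p) = (\<Sum>i\<le>k. measure p {i} * G i) + R"
proof -
  interpret prob_space p by fact
  have sp: "space p = UNIV" using sets_p sets_eq_imp_space_eq[of p "count_space UNIV"] by simp
  have meas [measurable]: "X \<in> borel_measurable p" for X :: "nat \<Rightarrow> real"
    by (rule measurableI) (simp_all add: sets_p)
  have [simp]: "X \<in> sets p" for X using sets_p by simp
  have int: "integrable p X" if "\<And>j. \<bar>X j\<bar> \<le> 1" for X :: "nat \<Rightarrow> real"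
    using that by (intro integrable_const_bound[where B = 1]) auto
  have split: "G j = (\<Sum>i\<le>k. G i * indicator {i} j) + G j * indicator {k<..} j" for j
  proof -
    have "(\<Sum>i\<le>k. G i * indicator {i} j) = (\<Sum>i\<le>k. if i = j then G i else 0)"
      by (intro sum.cong) (auto simp: indicator_def)
    then show ?thesis by (auto simp: indicator_def)
  qed
  have intR: "integrable p (\<lambda>j. G j * indicator {k<..} j)"
    using G by (intro int) (auto simp: indicator_def)
  have intS: "integrable p (\<lambda>j. G i * indicator {i} j)" for i
    using G by (intro int) (auto simp: indicator_def)
  have "(\<integral>j. G j \<partial>p) = (\<integral>j. (\<Sum>i\<le>k. G i * indicator {i} j) + G j * indicator {k<..} j \<partial>p)"
    by (subst split) (rule refl)
  also have "\<dots> = (\<integral>j. (\<Sum>i\<le>k. G i * indicator {i} j) \<partial>p) + (\<integral>j. G j * indicator {k<..} j \<partial>p)"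
    by (intro Bochner_Integration.integral_add Bochner_Integration.integrable_sum intS intR)
  also have "(\<integral>j. (\<Sum>i\<le>k. G i * indicator {i} j) \<partial>p) = (\<Sum>i\<le>k. \<integral>j. G i * indicator {i} j \<partial>p)"
    by (intro Bochner_Integration.integral_sum intS)
  also have "\<dots> = (\<Sum>i\<le>k. measure p {i} * G i)"
    by (simp add: sp mult.commute)
  finally have eq: "(\<integral>j. G j \<partial>p) = (\<Sum>i\<le>k. measure p {i} * G i) + (\<integral>j. G j * indicator {k<..} j \<partial>p)" .
  have "(\<integral>j. G j * indicator {k<..} j \<partial>p) \<le> (\<integral>j. indicator {k<..} j \<partial>p)"
    using G intR by (intro integral_mono int) (auto simp: indicator_def)
  also have "\<dots> = measure p {k<..}" by (simp add: sp)
  finally have "(\<integral>j. G j * indicator {k<..} j \<partial>p) \<le> measure p {k<..}" .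
  moreover have "0 \<le> (\<integral>j. G j * indicator {k<..} j \<partial>p)" using G by simp
  ultimately show ?thesis using eq by blast
qed

text \<open>
The integral of the difference telescopes to \<open>\<integral> f\<close> over \<open>[a, a + d]\<close> minus \<open>\<integral> f\<close> over \<open>[0, d]\<close>, and a monotone
function is bounded on these intervals by its values at the end points.
\<close>

lemma mono_integral_shift:
  fixes f :: "real \<Rightarrow> real"
  assumes mono: "mono f" and f: "\<And>x. 0 \<le> f x" "\<And>x. f x \<le> 1" and a: "0 \<le> a" and d: "0 \<le> d"
  shows "d * (f a - f d) \<le> (\<integral>x. indicator {0..a} x * (f (x + d) - f x) \<partial>lborel)"
    and "(\<integral>x. indicator {0..a} x * (f (x + d) - f x) \<partial>lborel) \<le> d * (f (a + d) - f 0)"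
proof -
  have [measurable]: "f \<in> borel_measurable borel" using mono by (rule borel_measurable_mono)
  have int: "integrable lborel (\<lambda>x. indicator A x * g x)"
    if "A \<subseteq> {b..b'}" "A \<in> sets borel" "b \<le> b'" "g \<in> borel_measurable borel" "\<And>x. \<bar>g x\<bar> \<le> 1"
    for A b b' and g :: "real \<Rightarrow> real"
  proof -
    have "emeasure lborel A \<le> emeasure lborel {b..b'}"
      using that by (intro emeasure_mono) auto
    also have "\<dots> < \<infinity>" using that by (simp add: emeasure_lborel_Icc_eq)
    finally show ?thesis
      using that integrableI_bounded_set_indicator[of A lborel g 1] by (simp add: mult.commute)
  qed
  have f1: "\<bar>f x\<bar> \<le> 1" for x using f by simp
  have sh: "(\<integral>x. indicator {0..a} x * f (x + d) \<partial>lborel) = (\<integral>x. indicator {d..a + d} x * f x \<partial>lborel)"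
    by (subst lborel_integral_real_affine[where c = 1 and t = d and f = "\<lambda>x. indicator {d..a + d} x * f x"])
      (auto intro!: Bochner_Integration.integral_cong simp: indicator_def add.commute)
  have "(\<integral>x. indicator {0..a} x * (f (x + d) - f x) \<partial>lborel) =
      (\<integral>x. indicator {d..a + d} x * f x \<partial>lborel) - (\<integral>x. indicator {0..a} x * f x \<partial>lborel)"
    unfolding sh[symmetric] using a f1
    by (subst Bochner_Integration.integral_diff[symmetric])
      (auto intro!: int[of _ 0 a] simp: right_diff_distrib)
  also have "\<dots> = (\<integral>x. indicator {d..a + d} x * f x - indicator {0..a} x * f x \<partial>lborel)"
    using a f1 d
    by (subst Bochner_Integration.integral_diff[OF int[of _ d "a + d"] int[of _ 0 a]]) auto
  also have "\<dots> = (\<integral>x. indicator {a<..a + d} x * f x - indicator {0..<d} x * f x \<partial>lborel)"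
    using a d by (intro Bochner_Integration.integral_cong) (auto simp: indicator_def)
  also have "\<dots> = (\<integral>x. indicator {a<..a + d} x * f x \<partial>lborel) - (\<integral>x. indicator {0..<d} x * f x \<partial>lborel)"
    using a f1 d
    by (intro Bochner_Integration.integral_diff int[of _ a "a + d"] int[of _ 0 d]) auto
  finally have eq: "(\<integral>x. indicator {0..a} x * (f (x + d) - f x) \<partial>lborel) = \<dots>" .
  have const: "(\<integral>x. indicator {a<..a + d} x * r \<partial>lborel) = d * r"
      "(\<integral>x. indicator {0..<d} x * r \<partial>lborel) = d * r" for r :: real
    using d by simp_all
  have iI: "integrable lborel (\<lambda>x. indicator {a<..a + d} x * r)"
      "integrable lborel (\<lambda>x. indicator {0..<d} x * r)" for r :: real
    using d by simp_all
  have 1: "d * f a \<le> (\<integral>x. indicator {a<..a + d} x * f x \<partial>lborel)"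
    unfolding const(1)[symmetric] using d f1
    by (intro integral_mono iI int[of _ a "a + d"]) (auto simp: indicator_def intro!: monoD[OF mono])
  have 2: "(\<integral>x. indicator {a<..a + d} x * f x \<partial>lborel) \<le> d * f (a + d)"
    unfolding const(1)[symmetric] using d f1
    by (intro integral_mono iI int[of _ a "a + d"]) (auto simp: indicator_def intro!: monoD[OF mono])
  have 3: "d * f 0 \<le> (\<integral>x. indicator {0..<d} x * f x \<partial>lborel)"
    unfolding const(2)[symmetric] using d f1
    by (intro integral_mono iI int[of _ 0 d]) (auto simp: indicator_def intro!: monoD[OF mono])
  have 4: "(\<integral>x. indicator {0..<d} x * f x \<partial>lborel) \<le> d * f d"
    unfolding const(2)[symmetric] using d f1
    by (intro integral_mono iI int[of _ 0 d]) (auto simp: indicator_def intro!: monoD[OF mono])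
  show "d * (f a - f d) \<le> (\<integral>x. indicator {0..a} x * (f (x + d) - f x) \<partial>lborel)"
    unfolding eq using 1 4 by (simp add: right_diff_distrib)
  show "(\<integral>x. indicator {0..a} x * (f (x + d) - f x) \<partial>lborel) \<le> d * (f (a + d) - f 0)"
    unfolding eq using 2 3 by (simp add: right_diff_distrib)
qed

text \<open>
Divide the one-step equation by \<open>h n\<close> and integrate over the initial value \<open>x \<in> [0, a]\<close>. Since the
function \<open>f n\<close> is bounded by 1 and changes by at most the probability of a jump over one step,
\<open>f n (x + c * h n)\<close> has the same limit as \<open>f n x\<close>, and the difference quotients are bounded uniformly. Dominated
convergence gives the limit of their integrals, while \<open>mono_integral_shift\<close> gives the limit of the
telescoped form.
\<close>

theorem integro_differential_limit:
  fixes f :: "nat \<Rightarrow> real \<Rightarrow> real" and \<phi> :: "real \<Rightarrow> real" and h :: "nat \<Rightarrow> real"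
    and p :: "nat \<Rightarrow> nat measure" and \<mu> :: "nat \<Rightarrow> real measure" and lam :: "nat \<Rightarrow> real"
  assumes mono: "\<And>n. mono (f n)" and f: "\<And>n x. 0 \<le> f n x" "\<And>n x. f n x \<le> 1"
    and neg: "\<And>n x. x < 0 \<Longrightarrow> f n x = 0" and lim: "\<And>x. (\<lambda>n. f n x) \<longlonglongrightarrow> \<phi> x"
    and c: "0 < c" and h: "\<And>n. 0 < h n" "h \<longlonglongrightarrow> 0"
    and p: "\<And>n. prob_space (p n)" "\<And>n. sets (p n) = UNIV"
    and \<mu>: "\<And>j. prob_space (\<mu> j)" "\<And>j. sets (\<mu> j) = sets borel" "\<mu> 0 = return borel 0"
    and step: "\<And>n x. 0 \<le> x \<Longrightarrow> f n x = (\<integral>j. \<integral>s. f n (x + c * h n - s) \<partial>\<mu> j \<partial>p n)"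
    and rate: "\<And>j. j \<in> {1..k} \<Longrightarrow> (\<lambda>n. measure (p n) {j} / h n) \<longlonglongrightarrow> lam j"
    and large: "(\<lambda>n. measure (p n) {k<..} / h n) \<longlonglongrightarrow> 0"
    and a: "0 \<le> a"
  shows "c * (\<phi> a - \<phi> 0) =
    (\<integral>x. indicator {0..a} x * ((\<Sum>j = 1..k. lam j) * \<phi> x - (\<Sum>j = 1..k. lam j * (\<integral>s. \<phi> (x - s) \<partial>\<mu> j))) \<partial>lborel)"
proof -
  have meas_f [measurable]: "f n \<in> borel_measurable borel" for n
    using mono by (rule borel_measurable_mono)
  have meas_phi [measurable]: "\<phi> \<in> borel_measurable borel"
    using lim meas_f by (rule borel_measurable_LIMSEQ_real)
  have [measurable_cong]: "sets (\<mu> j) = sets borel" for j by (rule \<mu>(2))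
  define E where "E n j x = (\<integral>s. f n (x + c * h n - s) \<partial>\<mu> j)" for n j x
  have E: "0 \<le> E n j x" "E n j x \<le> 1" for n j x
    unfolding E_def using \<mu>(1) f by (auto intro!: prob_integral_unit_interval)
  have [measurable]: "E n j \<in> borel_measurable borel" for n j
  proof -
    interpret prob_space "\<mu> j" by (rule \<mu>(1))
    show ?thesis unfolding E_def[abs_def] by measurable
  qed
  \<comment> \<open>The probability of at least one claim in a step.\<close>
  define q where "q n = (\<Sum>j = 1..k. measure (p n) {j}) + measure (p n) {k<..}" for n
  have q0: "measure (p n) {0} = 1 - q n" for n
  proof -
    interpret prob_space "p n" by (rule p)
    have sp: "space (p n) = UNIV" using p(2)[of n] sets_eq_imp_space_eq[of "p n" "count_space UNIV"] by simp
    have UN: "{..k} \<union> {k<..} = (UNIV :: nat set)" by auto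
    have "1 = prob (\<Union>i\<in>{..k}. {i}) + prob {k<..}"
      using prob_space p(2)[of n]
      by (subst finite_measure_Union[symmetric]) (auto simp: sp UN)
    also have "prob (\<Union>i\<in>{..k}. {i}) = (\<Sum>i\<le>k. prob {i})"
      using p(2)[of n] by (intro finite_measure_finite_Union) (auto simp: disjoint_family_on_def)
    also have "\<dots> = prob {0} + (\<Sum>i = 1..k. prob {i})"
      by (simp add: atMost_atLeast0 sum.atLeast_Suc_atMost)
    finally show ?thesis by (simp add: q_def)
  qed
  have E0: "E n 0 x = f n (x + c * h n)" for n x
    unfolding E_def \<mu>(3) by (subst integral_return) auto
  have step': "\<exists>R. 0 \<le> R \<and> R \<le> measure (p n) {k<..} \<and>
      f n (x + c * h n) - f n x = q n * f n (x + c * h n) - (\<Sum>j = 1..k. measure (p n) {j} * E n j x) - R"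
    if "0 \<le> x" for n x
  proof -
    obtain R where R: "0 \<le> R" "R \<le> measure (p n) {k<..}"
      "(\<integral>j. E n j x \<partial>p n) = (\<Sum>i\<le>k. measure (p n) {i} * E n i x) + R"
      using integral_nat_split[OF p(1)[of n] p(2)[of n], where G = "\<lambda>j. E n j x" and k = k] E by blast
    then have "f n x = (\<Sum>i\<le>k. measure (p n) {i} * E n i x) + R"
      using step[OF that, of n] by (simp add: E_def)
    also have "\<dots> = (1 - q n) * f n (x + c * h n) + (\<Sum>j = 1..k. measure (p n) {j} * E n j x) + R"
      by (simp add: atMost_atLeast0 sum.atLeast_Suc_atMost q0 E0)
    finally show ?thesis using R by (intro exI[of _ R]) (simp add: algebra_simps)
  qed
  have q_rate: "(\<lambda>n. q n / h n) \<longlonglongrightarrow> (\<Sum>j = 1..k. lam j) + 0"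
    unfolding q_def add_divide_distrib sum_divide_distrib by (intro tendsto_intros rate large)
  have "(\<lambda>n. q n / h n * h n) \<longlonglongrightarrow> ((\<Sum>j = 1..k. lam j) + 0) * 0"
    by (intro tendsto_mult q_rate h)
  then have q_null: "q \<longlonglongrightarrow> 0" using h(1) by (simp add: less_imp_neq[symmetric])
  have osc: "f n x \<le> f n (x + c * h n)" "f n (x + c * h n) \<le> f n x + q n" if "0 \<le> x" for n x
  proof -
    show "f n x \<le> f n (x + c * h n)" using c h(1)[of n] by (intro monoD[OF mono]) simp
    have "0 \<le> (\<Sum>j = 1..k. measure (p n) {j} * E n j x)"
      using E by (intro sum_nonneg) auto
    moreover have "q n * f n (x + c * h n) \<le> q n * 1"
      using f by (intro mult_left_mono) (auto simp: q_def intro!: add_nonneg_nonneg sum_nonneg)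
    ultimately show "f n (x + c * h n) \<le> f n x + q n"
      using step'[OF that, of n] by auto
  qed
  have lim_shift: "(\<lambda>n. f n (x + c * h n)) \<longlonglongrightarrow> \<phi> x" if "0 \<le> x" for x
  proof (rule tendsto_sandwich)
    show "(\<lambda>n. f n x) \<longlonglongrightarrow> \<phi> x" by (rule lim)
    show "(\<lambda>n. f n x + q n) \<longlonglongrightarrow> \<phi> x" using tendsto_add[OF lim q_null] by simp
  qed (use osc[OF that] in auto)
  have lim_shift': "(\<lambda>n. f n (x + c * h n)) \<longlonglongrightarrow> \<phi> x" for x
  proof (cases "0 \<le> x")
    case False
    have "(\<lambda>n. x + c * h n) \<longlonglongrightarrow> x + c * 0" by (intro tendsto_intros h)
    then have "\<forall>\<^sub>F n in sequentially. x + c * h n < 0"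
      using False by (intro order_tendstoD(2)[where y = "x + c * 0"]) auto
    then have "\<forall>\<^sub>F n in sequentially. f n x = f n (x + c * h n)"
      by eventually_elim (use False neg in auto)
    then show ?thesis using lim[of x] by (rule Lim_transform_eventually[rotated])
  qed (rule lim_shift)
  have lim_E: "(\<lambda>n. E n j x) \<longlonglongrightarrow> (\<integral>s. \<phi> (x - s) \<partial>\<mu> j)" for j x
  proof -
    interpret prob_space "\<mu> j" by (rule \<mu>(1))
    show ?thesis unfolding E_def
    proof (rule integral_dominated_convergence[where w = "\<lambda>_. 1"])
      show "AE s in \<mu> j. (\<lambda>n. f n (x + c * h n - s)) \<longlonglongrightarrow> \<phi> (x - s)"
      proof (rule AE_I2)
        fix s
        show "(\<lambda>n. f n (x + c * h n - s)) \<longlonglongrightarrow> \<phi> (x - s)"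
          using lim_shift'[of "x - s"] by (simp add: algebra_simps)
      qed
    qed (use f in auto)
  qed
  define D where "D n x = (f n (x + c * h n) - f n x) / h n" for n x
  have lim_D: "(\<lambda>n. D n x) \<longlonglongrightarrow>
      (\<Sum>j = 1..k. lam j) * \<phi> x - (\<Sum>j = 1..k. lam j * (\<integral>s. \<phi> (x - s) \<partial>\<mu> j))" if x: "0 \<le> x" for x
  proof -
    define L where "L n = q n / h n * f n (x + c * h n) - (\<Sum>j = 1..k. measure (p n) {j} / h n * E n j x)" for n
    have "L \<longlonglongrightarrow> ((\<Sum>j = 1..k. lam j) + 0) * \<phi> x - (\<Sum>j = 1..k. lam j * (\<integral>s. \<phi> (x - s) \<partial>\<mu> j))"
      unfolding L_def by (intro tendsto_intros q_rate lim_shift x rate lim_E)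
    moreover have "(\<lambda>n. D n x - L n) \<longlonglongrightarrow> 0"
    proof (rule Lim_null_comparison[OF _ large], rule always_eventually, rule allI)
      fix n
      obtain R where R: "0 \<le> R" "R \<le> measure (p n) {k<..}"
        "f n (x + c * h n) - f n x = q n * f n (x + c * h n) - (\<Sum>j = 1..k. measure (p n) {j} * E n j x) - R"
        using step'[OF x] by blast
      have "D n x - L n = - R / h n"
        unfolding D_def L_def R(3) by (simp add: diff_divide_distrib sum_divide_distrib)
      then show "norm (D n x - L n) \<le> measure (p n) {k<..} / h n"
        using R h(1)[of n] by (simp add: divide_right_mono)
    qed
    ultimately have "(\<lambda>n. L n + (D n x - L n)) \<longlonglongrightarrow>
        ((\<Sum>j = 1..k. lam j) + 0) * \<phi> x - (\<Sum>j = 1..k. lam j * (\<integral>s. \<phi> (x - s) \<partial>\<mu> j)) + 0"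
      by (rule tendsto_add)
    then show ?thesis by simp
  qed
  have "Bseq (\<lambda>n. q n / h n)" using q_rate by (intro convergent_imp_Bseq) (auto simp: convergent_def)
  then obtain K where K: "\<And>n. norm (q n / h n) \<le> K" unfolding Bseq_def by blast
  have "(\<lambda>n. \<integral>x. indicator {0..a} x * D n x \<partial>lborel) \<longlonglongrightarrow>
    (\<integral>x. indicator {0..a} x * ((\<Sum>j = 1..k. lam j) * \<phi> x - (\<Sum>j = 1..k. lam j * (\<integral>s. \<phi> (x - s) \<partial>\<mu> j))) \<partial>lborel)"
  proof (rule integral_dominated_convergence[where w = "\<lambda>x. indicator {0..a} x * K"])
    have "(\<lambda>x. \<integral>s. \<phi> (x - s) \<partial>\<mu> j) \<in> borel_measurable borel" for j
    proof -
      interpret prob_space "\<mu> j" by (rule \<mu>(1))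
      show ?thesis by measurable
    qed
    then show "(\<lambda>x. indicator {0..a} x * ((\<Sum>j = 1..k. lam j) * \<phi> x - (\<Sum>j = 1..k. lam j * (\<integral>s. \<phi> (x - s) \<partial>\<mu> j))))
      \<in> borel_measurable lborel"
      by measurable
    show "(\<lambda>x. indicator {0..a} x * D n x) \<in> borel_measurable lborel" for n
      unfolding D_def by measurable
    show "integrable lborel (\<lambda>x. indicator {0..a} x * K)" using a by simp
    show "AE x in lborel. (\<lambda>n. indicator {0..a} x * D n x) \<longlonglongrightarrow>
      indicator {0..a} x * ((\<Sum>j = 1..k. lam j) * \<phi> x - (\<Sum>j = 1..k. lam j * (\<integral>s. \<phi> (x - s) \<partial>\<mu> j)))"
    proof (rule AE_I2)
      fix x :: real
      show "(\<lambda>n. indicator {0..a} x * D n x) \<longlonglongrightarrow>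
        indicator {0..a} x * ((\<Sum>j = 1..k. lam j) * \<phi> x - (\<Sum>j = 1..k. lam j * (\<integral>s. \<phi> (x - s) \<partial>\<mu> j)))"
      proof (cases "x \<in> {0..a}")
        case True
        then have "0 \<le> x" by simp
        then show ?thesis by (intro tendsto_mult tendsto_const lim_D)
      qed simp
    qed
    show "AE x in lborel. norm (indicator {0..a} x * D n x) \<le> indicator {0..a} x * K" for n
    proof (rule AE_I2)
      fix x :: real
      show "norm (indicator {0..a} x * D n x) \<le> indicator {0..a} x * K"
      proof (cases "x \<in> {0..a}")
        case True
        then have "\<bar>D n x\<bar> \<le> q n / h n"
          using osc[of x n] h(1)[of n] by (auto simp: D_def divide_right_mono)
        also have "\<dots> \<le> K"
          using abs_ge_self[of "q n / h n"] K[of n] unfolding real_norm_def by (rule order.trans)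
        finally show ?thesis using True by simp
      qed simp
    qed
  qed
  moreover have "(\<lambda>n. \<integral>x. indicator {0..a} x * D n x \<partial>lborel) \<longlonglongrightarrow> c * (\<phi> a - \<phi> 0)"
  proof -
    define J where "J n = (\<integral>x. indicator {0..a} x * (f n (x + c * h n) - f n x) \<partial>lborel)" for n
    have J: "(\<integral>x. indicator {0..a} x * D n x \<partial>lborel) = J n / h n" for n
      unfolding D_def J_def by simp
    show ?thesis unfolding J
    proof (rule tendsto_sandwich)
      have "(\<lambda>n. c * (f n a - f n (0 + c * h n))) \<longlonglongrightarrow> c * (\<phi> a - \<phi> 0)"
        by (intro tendsto_intros lim lim_shift) simp
      then show "(\<lambda>n. c * (f n a - f n (c * h n))) \<longlonglongrightarrow> c * (\<phi> a - \<phi> 0)" by simp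
      show "(\<lambda>n. c * (f n (a + c * h n) - f n 0)) \<longlonglongrightarrow> c * (\<phi> a - \<phi> 0)"
        by (intro tendsto_intros lim lim_shift a)
      have le: "c * (f n a - f n (c * h n)) \<le> J n / h n"
        "J n / h n \<le> c * (f n (a + c * h n) - f n 0)" for n
      proof -
        have ch: "0 \<le> c * h n" using c h(1)[of n] by simp
        have "c * (f n a - f n (c * h n)) * h n = c * h n * (f n a - f n (c * h n))"
          "c * (f n (a + c * h n) - f n 0) * h n = c * h n * (f n (a + c * h n) - f n 0)"
          by (simp_all only: mult.assoc mult.commute mult.left_commute)
        then show "c * (f n a - f n (c * h n)) \<le> J n / h n"
          "J n / h n \<le> c * (f n (a + c * h n) - f n 0)"
          using mono_integral_shift[OF mono[of n] f(1)[of n] f(2)[of n] a ch]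
          by (simp_all only: J_def pos_le_divide_eq[OF h(1)] pos_divide_le_eq[OF h(1)])
      qed
      show "\<forall>\<^sub>F n in sequentially. c * (f n a - f n (c * h n)) \<le> J n / h n"
        by (intro always_eventually allI le)
      show "\<forall>\<^sub>F n in sequentially. J n / h n \<le> c * (f n (a + c * h n) - f n 0)"
        by (intro always_eventually allI le)
    qed
  qed
  ultimately show ?thesis by (rule LIMSEQ_unique[rotated])
qed

section \<open>From the generator to a renewal equation\<close>

text \<open>
The substitution \<open>x = v + s\<close> for fixed \<open>s\<close>, between two applications of Fubini's theorem: the measure of
the set of admissible \<open>s\<close> for given \<open>v\<close> is a value of the distribution function.
\<close>

lemma integral_translate_law_eq_cdf:
  fixes \<phi> :: "real \<Rightarrow> real" and \<mu> :: "real measure"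
  assumes \<mu>: "prob_space \<mu>" and [measurable_cong]: "sets \<mu> = sets borel"
    and nonneg: "AE s in \<mu>. 0 \<le> s"
    and [measurable]: "\<phi> \<in> borel_measurable borel" and \<phi>: "\<And>x. \<bar>\<phi> x\<bar> \<le> B" "\<And>x. x < 0 \<Longrightarrow> \<phi> x = 0"
  shows "(\<integral>x. indicator {0..a} x * (\<integral>s. \<phi> (x - s) \<partial>\<mu>) \<partial>lborel) =
    (\<integral>v. indicator {0..a} v * (\<phi> v * measure \<mu> {..a - v}) \<partial>lborel)"
proof -
  interpret \<mu>: prob_space \<mu> by fact
  interpret L: pair_sigma_finite lborel \<mu> ..
  have sp: "space \<mu> = UNIV" using sets_eq_imp_space_eq[of \<mu> borel] assms(2) by simp
  have B: "0 \<le> B" using \<phi>(1)[of 0] by simp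
  define K where "K x s = (if 0 \<le> x \<and> x \<le> a \<and> 0 \<le> s then \<phi> (x - s) else 0)" for x s
  define J where "J v s = (if 0 \<le> v \<and> v \<le> a \<and> 0 \<le> s \<and> s \<le> a - v then \<phi> v else 0)" for v s
  have fin: "emeasure (lborel \<Otimes>\<^sub>M \<mu>) ({0..a} \<times> UNIV) < \<infinity>"
    using \<mu>.emeasure_pair_measure_Times[of "{0..a}" lborel UNIV] sp \<mu>.emeasure_space_1
    by (simp add: emeasure_lborel_Icc_eq)
  have int: "integrable (lborel \<Otimes>\<^sub>M \<mu>) (\<lambda>(x, s). F x s)"
    if [measurable]: "(\<lambda>(x, s). F x s) \<in> borel_measurable (lborel \<Otimes>\<^sub>M \<mu>)"
      and "\<And>x s. \<bar>F x s\<bar> \<le> B" "\<And>x s. x \<notin> {0..a} \<Longrightarrow> F x s = 0" for F :: "real \<Rightarrow> real \<Rightarrow> real"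
  proof (rule integrableI_bounded_set[where A = "{0..a} \<times> UNIV" and B = B])
    show "{0..a} \<times> UNIV \<in> sets (lborel \<Otimes>\<^sub>M \<mu>)"
      by (intro pair_measureI) (auto simp: assms(2))
    show "AE q in lborel \<Otimes>\<^sub>M \<mu>. q \<notin> {0..a} \<times> UNIV \<longrightarrow> (case q of (x, s) \<Rightarrow> F x s) = 0"
      using that(3) by (intro AE_I2) (auto simp del: atLeastAtMost_iff)
  qed (use that fin in auto)
  have K: "integrable (lborel \<Otimes>\<^sub>M \<mu>) (\<lambda>(x, s). K x s)"
    using \<phi> B by (intro int) (auto simp: K_def)
  have J: "integrable (lborel \<Otimes>\<^sub>M \<mu>) (\<lambda>(x, s). J x s)"
    using \<phi> B by (intro int) (auto simp: J_def)
  have "(\<integral>x. indicator {0..a} x * (\<integral>s. \<phi> (x - s) \<partial>\<mu>) \<partial>lborel) = (\<integral>x. \<integral>s. K x s \<partial>\<mu> \<partial>lborel)"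
  proof (rule Bochner_Integration.integral_cong[OF refl])
    fix x :: real
    have "(\<integral>s. \<phi> (x - s) \<partial>\<mu>) = (\<integral>s. K x s \<partial>\<mu>)" if "x \<in> {0..a}"
      using nonneg that by (intro integral_cong_AE) (auto simp: K_def)
    then show "indicator {0..a} x * (\<integral>s. \<phi> (x - s) \<partial>\<mu>) = (\<integral>s. K x s \<partial>\<mu>)"
      by (cases "x \<in> {0..a}") (auto simp: K_def)
  qed
  also have "\<dots> = (\<integral>s. \<integral>x. K x s \<partial>lborel \<partial>\<mu>)"
    by (rule L.Fubini_integral[OF K, symmetric])
  also have "\<dots> = (\<integral>s. \<integral>v. J v s \<partial>lborel \<partial>\<mu>)"
  proof (rule Bochner_Integration.integral_cong[OF refl])
    fix s :: real
    have "(\<integral>x. K x s \<partial>lborel) = (\<integral>v. K (s + v) s \<partial>lborel)"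
      by (subst lborel_integral_real_affine[where c = 1 and t = s]) auto
    also have "\<dots> = (\<integral>v. J v s \<partial>lborel)"
      by (intro Bochner_Integration.integral_cong refl) (use \<phi>(2) in \<open>auto simp: K_def J_def not_le\<close>)
    finally show "(\<integral>x. K x s \<partial>lborel) = (\<integral>v. J v s \<partial>lborel)" .
  qed
  also have "\<dots> = (\<integral>v. \<integral>s. J v s \<partial>\<mu> \<partial>lborel)"
    by (rule L.Fubini_integral[OF J])
  also have "\<dots> = (\<integral>v. indicator {0..a} v * (\<phi> v * measure \<mu> {..a - v}) \<partial>lborel)"
  proof (rule Bochner_Integration.integral_cong[OF refl])
    fix v :: real
    have "(\<integral>s. J v s \<partial>\<mu>) = \<phi> v * measure \<mu> {..a - v}" if "v \<in> {0..a}"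
    proof -
      have "(\<integral>s. J v s \<partial>\<mu>) = (\<integral>s. \<phi> v * indicator {..a - v} s \<partial>\<mu>)"
        using nonneg that by (intro integral_cong_AE) (auto simp: J_def indicator_def)
      then show ?thesis by (simp add: sp)
    qed
    then show "(\<integral>s. J v s \<partial>\<mu>) = indicator {0..a} v * (\<phi> v * measure \<mu> {..a - v})"
      by (cases "v \<in> {0..a}") (auto simp: J_def)
  qed
  finally show ?thesis .
qed

text \<open>
The sum of the rates multiplies \<open>\<phi>\<close>, and the expectations contribute distribution functions; together
they form the tail \<open>1 - measure (\<mu> j) {..y}\<close> that is the kernel of the renewal equation.
\<close>

lemma integrated_generator_eq_renewal:
  fixes \<phi> :: "real \<Rightarrow> real" and \<mu> :: "nat \<Rightarrow> real measure" and lam :: "nat \<Rightarrow> real"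
  assumes \<mu>: "\<And>j. prob_space (\<mu> j)" "\<And>j. sets (\<mu> j) = sets borel"
    and nonneg: "\<And>j. j \<in> {1..k} \<Longrightarrow> AE s in \<mu> j. 0 \<le> s"
    and [measurable]: "\<phi> \<in> borel_measurable borel"
    and \<phi>: "\<And>x. 0 \<le> \<phi> x" "\<And>x. \<phi> x \<le> 1" "\<And>x. x < 0 \<Longrightarrow> \<phi> x = 0"
  shows "(\<integral>x. indicator {0..a} x * ((\<Sum>j = 1..k. lam j) * \<phi> x - (\<Sum>j = 1..k. lam j * (\<integral>s. \<phi> (x - s) \<partial>\<mu> j))) \<partial>lborel) =
    (\<integral>v. indicator {0..a} v * (\<phi> v * (\<Sum>j = 1..k. lam j * (1 - measure (\<mu> j) {..a - v}))) \<partial>lborel)"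
proof -
  have [measurable_cong]: "sets (\<mu> j) = sets borel" for j by (rule \<mu>(2))
  have int: "integrable lborel (\<lambda>x. indicator {0..a} x * G x)"
    if [measurable]: "G \<in> borel_measurable borel" and "\<And>x. \<bar>G x\<bar> \<le> 1" for G :: "real \<Rightarrow> real"
    using that integrableI_bounded_set_indicator[of "{0..a}" lborel G 1]
    by (simp add: emeasure_lborel_Icc_eq)
  have int_\<phi>: "integrable lborel (\<lambda>x. indicator {0..a} x * \<phi> x)"
    using \<phi> by (intro int) auto
  have int_E: "integrable lborel (\<lambda>x. indicator {0..a} x * (\<integral>s. \<phi> (x - s) \<partial>\<mu> j))" for j
  proof (rule int)
    interpret prob_space "\<mu> j" by (rule \<mu>(1))
    show "(\<lambda>x. \<integral>s. \<phi> (x - s) \<partial>\<mu> j) \<in> borel_measurable borel" by measurable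
    show "\<bar>\<integral>s. \<phi> (x - s) \<partial>\<mu> j\<bar> \<le> 1" for x
      using prob_integral_unit_interval[OF \<mu>(1), of "\<lambda>s. \<phi> (x - s)" j] \<phi> by simp
  qed
  have int_F: "integrable lborel (\<lambda>v. indicator {0..a} v * (\<phi> v * measure (\<mu> j) {..a - v}))" for j
  proof (rule int)
    interpret prob_space "\<mu> j" by (rule \<mu>(1))
    have "mono (\<lambda>x. measure (\<mu> j) {..x})"
      by (intro monoI finite_measure_mono) (auto simp: \<mu>(2))
    then have "(\<lambda>x. measure (\<mu> j) {..x}) \<in> borel_measurable borel"
      by (rule borel_measurable_mono)
    then have "(\<lambda>v. measure (\<mu> j) {..a - v}) \<in> borel_measurable borel"
      by (rule measurable_compose[rotated]) simp
    then show "(\<lambda>v. \<phi> v * measure (\<mu> j) {..a - v}) \<in> borel_measurable borel" by simp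
    show "\<bar>\<phi> v * measure (\<mu> j) {..a - v}\<bar> \<le> 1" for v
      using \<phi> by (simp add: abs_mult mult_le_one)
  qed
  have "(\<integral>x. indicator {0..a} x * ((\<Sum>j = 1..k. lam j) * \<phi> x - (\<Sum>j = 1..k. lam j * (\<integral>s. \<phi> (x - s) \<partial>\<mu> j))) \<partial>lborel) =
      (\<integral>x. (\<Sum>j = 1..k. lam j * (indicator {0..a} x * \<phi> x) - lam j * (indicator {0..a} x * (\<integral>s. \<phi> (x - s) \<partial>\<mu> j))) \<partial>lborel)"
    by (intro Bochner_Integration.integral_cong refl)
      (simp add: sum_subtractf sum_distrib_left sum_distrib_right right_diff_distrib mult_ac)
  also have "\<dots> = (\<Sum>j = 1..k. lam j * (\<integral>x. indicator {0..a} x * \<phi> x \<partial>lborel) -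
      lam j * (\<integral>x. indicator {0..a} x * (\<integral>s. \<phi> (x - s) \<partial>\<mu> j) \<partial>lborel))"
    using int_\<phi> int_E
    by (subst Bochner_Integration.integral_sum) (auto intro!: sum.cong simp: Bochner_Integration.integral_diff)
  also have "\<dots> = (\<Sum>j = 1..k. lam j * (\<integral>x. indicator {0..a} x * \<phi> x \<partial>lborel) -
      lam j * (\<integral>v. indicator {0..a} v * (\<phi> v * measure (\<mu> j) {..a - v}) \<partial>lborel))"
  proof (intro sum.cong refl)
    fix j assume j: "j \<in> {1..k}"
    have "(\<integral>x. indicator {0..a} x * (\<integral>s. \<phi> (x - s) \<partial>\<mu> j) \<partial>lborel) =
        (\<integral>v. indicator {0..a} v * (\<phi> v * measure (\<mu> j) {..a - v}) \<partial>lborel)"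
      by (rule integral_translate_law_eq_cdf[OF \<mu> nonneg[OF j], where B = 1]) (use \<phi> in auto)
    then show "lam j * (\<integral>x. indicator {0..a} x * \<phi> x \<partial>lborel) -
        lam j * (\<integral>x. indicator {0..a} x * (\<integral>s. \<phi> (x - s) \<partial>\<mu> j) \<partial>lborel) =
      lam j * (\<integral>x. indicator {0..a} x * \<phi> x \<partial>lborel) -
        lam j * (\<integral>v. indicator {0..a} v * (\<phi> v * measure (\<mu> j) {..a - v}) \<partial>lborel)" by simp
  qed
  also have "\<dots> = (\<integral>x. (\<Sum>j = 1..k. lam j * (indicator {0..a} x * \<phi> x) -
      lam j * (indicator {0..a} x * (\<phi> x * measure (\<mu> j) {..a - x}))) \<partial>lborel)"
    using int_\<phi> int_F
    by (subst Bochner_Integration.integral_sum) (auto intro!: sum.cong simp: Bochner_Integration.integral_diff)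
  also have "\<dots> = (\<integral>v. indicator {0..a} v * (\<phi> v * (\<Sum>j = 1..k. lam j * (1 - measure (\<mu> j) {..a - v}))) \<partial>lborel)"
    by (intro Bochner_Integration.integral_cong refl)
      (simp add: sum_subtractf sum_distrib_left sum_distrib_right right_diff_distrib mult_ac)
  finally show ?thesis .
qed


section \<open>The counting process observed on a time skeleton\<close>

context generalized_counting_process begin

definition increment :: "real \<Rightarrow> nat \<Rightarrow> 'a \<Rightarrow> nat" where
  "increment h l \<omega> = M (real (Suc l) * h) \<omega> - M (real l * h) \<omega>"

lemma sum_increment:
  assumes "\<omega> \<in> space P" "0 \<le> h"
  shows "(\<Sum>l<n. increment h l \<omega>) = M (real n * h) \<omega> - M 0 \<omega>"
proof (induction n)
  case (Suc n)
  have "M 0 \<omega> \<le> M (real n * h) \<omega>" "M (real n * h) \<omega> \<le> M (real (Suc n) * h) \<omega>"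
    using assms by (auto intro!: mono_onD[OF mono_paths[OF assms(1)]] mult_right_mono)
  then show ?case using Suc by (simp add: increment_def)
qed simp

lemma measurable_increment [measurable]:
  assumes "0 \<le> h" shows "increment h l \<in> measurable P (count_space UNIV)"
proof -
  have [measurable]: "M (real (Suc l) * h) \<in> measurable P (count_space UNIV)"
    "M (real l * h) \<in> measurable P (count_space UNIV)"
    using assms by (auto intro!: measurable_at simp del: of_nat_Suc)
  show ?thesis unfolding increment_def[abs_def] by measurable
qed

lemma indep_increments:
  assumes "0 < h"
  shows "indep_vars (\<lambda>_. count_space UNIV) (increment h) {..<N}"
  using independent_increments[of "\<lambda>i. real i * h" N] assms
  by (simp add: increment_def[abs_def])

lemma distr_increment:
  assumes "0 < h"
  shows "distr P (count_space UNIV) (increment h l) = distr P (count_space UNIV) (\<lambda>\<omega>. M h \<omega> - M 0 \<omega>)"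
  using stationary_increments[of "real l * h" h] assms
  by (simp add: increment_def[abs_def] algebra_simps)

text \<open>
The increments are a measurable function of the whole path, so their vector inherits independence from
the generated sigma-algebras. Independence is stated as an identity of laws since the two vectors
take values in different types.
\<close>

lemma increments_indep_claims:
  fixes Z :: "nat \<Rightarrow> 'a \<Rightarrow> real"
  assumes h: "0 < h" and [measurable]: "\<And>i. 1 \<le> i \<Longrightarrow> Z i \<in> borel_measurable P"
    and indep: "indep_set (process_algebra P {0..} (count_space UNIV) M) (process_algebra P {1..} borel Z)"
  shows "distr P (PiM {..<N} (\<lambda>_. count_space UNIV) \<Otimes>\<^sub>M PiM {1..} (\<lambda>_. borel))
        (\<lambda>\<omega>. (\<lambda>l\<in>{..<N}. increment h l \<omega>, \<lambda>i\<in>{1..}. Z i \<omega>)) =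
      distr P (PiM {..<N} (\<lambda>_. count_space UNIV)) (\<lambda>\<omega>. \<lambda>l\<in>{..<N}. increment h l \<omega>) \<Otimes>\<^sub>M
      distr P (PiM {1..} (\<lambda>_. borel)) (\<lambda>\<omega>. \<lambda>i\<in>{1..}. Z i \<omega>)"
proof -
  define X where "X \<omega> = (\<lambda>l\<in>{..<N}. increment h l \<omega>)" for \<omega>
  define Y where "Y \<omega> = (\<lambda>i\<in>{1..}. Z i \<omega>)" for \<omega>
  define V where "V \<omega> = (\<lambda>t\<in>{0..}. M t \<omega>)" for \<omega>
  let ?C = "PiM {..<N} (\<lambda>_. count_space UNIV :: nat measure)"
  define A where "A = {1::nat..}"
  let ?B = "PiM A (\<lambda>_. borel :: real measure)"
  let ?V = "PiM {0..} (\<lambda>_. count_space UNIV) :: (real \<Rightarrow> nat) measure"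
  \<comment> \<open>Reads off the increments from a path.\<close>
  define \<Delta> where "\<Delta> m = (\<lambda>l\<in>{..<N}. m (real (Suc l) * h) - m (real l * h))" for m :: "real \<Rightarrow> nat"
  have rv [measurable]: "X \<in> measurable P ?C" "Y \<in> measurable P ?B"
    using h unfolding X_def[abs_def] Y_def[abs_def] A_def by (auto intro!: measurable_restrict)
  have V: "V \<in> space P \<rightarrow> space ?V" by (auto simp: V_def space_PiM)
  have \<Delta>: "\<Delta> \<in> measurable ?V ?C"
    unfolding \<Delta>_def[abs_def]
  proof (rule measurable_restrict)
    fix l
    have c: "(\<lambda>m. m (real (Suc l) * h)) \<in> measurable ?V (count_space UNIV)"
      "(\<lambda>m. m (real l * h)) \<in> measurable ?V (count_space UNIV)"
      using h by (intro measurable_component_singleton; simp)+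
    show "(\<lambda>m. m (real (Suc l) * h) - m (real l * h)) \<in> measurable ?V (count_space UNIV)"
      by (rule measurable_compose_countable[where f = "\<lambda>i m. i - m (real l * h)", OF _ c(1)])
        (rule measurable_compose[OF c(2)], simp)
  qed
  have X_V: "X \<omega> = \<Delta> (V \<omega>)" for \<omega>
    using h by (auto simp: X_def \<Delta>_def V_def increment_def fun_eq_iff)
  interpret X: prob_space "distr P ?C X" by (rule prob_space_distr) (rule rv)
  interpret Y: prob_space "distr P ?B Y" by (rule prob_space_distr) (rule rv)
  have "distr P ?C X \<Otimes>\<^sub>M distr P ?B Y = distr P (?C \<Otimes>\<^sub>M ?B) (\<lambda>\<omega>. (X \<omega>, Y \<omega>))"
  proof (rule pair_measure_eqI)
    fix E F assume "E \<in> sets (distr P ?C X)" "F \<in> sets (distr P ?B Y)"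
    then have E [measurable]: "E \<in> sets ?C" and F [measurable]: "F \<in> sets ?B" by auto
    have "X -` E \<inter> space P = V -` (\<Delta> -` E \<inter> space ?V) \<inter> space P"
      using V by (auto simp: X_V)
    also have "\<dots> \<in> process_algebra P {0..} (count_space UNIV) M"
      unfolding process_algebra_def V_def[abs_def]
      by (rule in_vimage_algebra) (rule measurable_sets[OF \<Delta> E])
    finally have 1: "X -` E \<inter> space P \<in> process_algebra P {0..} (count_space UNIV) M" .
    have 2: "Y -` F \<inter> space P \<in> process_algebra P {1..} borel Z"
      unfolding process_algebra_def Y_def[abs_def] A_def[symmetric]
      by (rule in_vimage_algebra) (rule F)
    have "prob ((X -` E \<inter> space P) \<inter> (Y -` F \<inter> space P)) = prob (X -` E \<inter> space P) * prob (Y -` F \<inter> space P)"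
      by (rule indep_setD[OF indep 1 2])
    moreover have "(X -` E \<inter> space P) \<inter> (Y -` F \<inter> space P) = (\<lambda>\<omega>. (X \<omega>, Y \<omega>)) -` (E \<times> F) \<inter> space P"
      by auto
    ultimately show "emeasure (distr P ?C X) E * emeasure (distr P ?B Y) F =
        emeasure (distr P (?C \<Otimes>\<^sub>M ?B) (\<lambda>\<omega>. (X \<omega>, Y \<omega>))) (E \<times> F)"
      by (simp add: emeasure_distr emeasure_eq_measure ennreal_mult)
  qed (auto intro: X.sigma_finite_measure_axioms Y.sigma_finite_measure_axioms cong: sets_pair_measure_cong)
  then show ?thesis unfolding X_def[abs_def] Y_def[abs_def] A_def by (rule sym)
qed

lemma measurable_surplus:
  assumes "\<And>i. 1 \<le> i \<Longrightarrow> Z i \<in> borel_measurable P" "0 \<le> t"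
  shows "surplus c M Z u t \<in> borel_measurable P"
proof -
  have "(\<lambda>\<omega>. (\<lambda>m \<omega>. \<Sum>i = 1..m. Z i \<omega>) (M t \<omega>) \<omega>) \<in> borel_measurable P"
  proof (rule measurable_compose_countable[where f = "\<lambda>m \<omega>. \<Sum>i = 1..m. Z i \<omega>"])
    show "M t \<in> measurable P (count_space UNIV)" using assms(2) by (rule measurable_at)
    show "(\<lambda>\<omega>. \<Sum>i = 1..m. Z i \<omega>) \<in> borel_measurable P" for m
      using assms(1) by (intro borel_measurable_sum) auto
  qed
  then show ?thesis unfolding surplus_def[abs_def] by simp
qed

text \<open>
Approach \<open>t\<close> from the right by dyadic times. The claim count is integer-valued and right-continuous,
hence eventually equal to its value at \<open>t\<close>, and the surplus along these times converges to the surplus at \<open>t\<close>.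
\<close>

lemma surplus_nonneg_of_dyadic:
  assumes \<omega>: "\<omega> \<in> space P" and t: "0 < t"
    and dyadic: "\<And>n N. 1 \<le> N \<Longrightarrow> 0 \<le> surplus c M Z u (real N * (1/2)^n) \<omega>"
  shows "0 \<le> surplus c M Z u t \<omega>"
proof -
  \<comment> \<open>The smallest dyadic time of level n that is strictly larger than t.\<close>
  define N where "N n = Suc (nat \<lfloor>t * 2 ^ n\<rfloor>)" for n
  define s where "s n = real (N n) * (1/2)^n" for n
  have N: "t * 2 ^ n < real (N n)" "real (N n) \<le> t * 2 ^ n + 1" for n
  proof -
    have "real (N n) = of_int \<lfloor>t * 2 ^ n\<rfloor> + 1" using t by (simp add: N_def)
    then show "t * 2 ^ n < real (N n)" "real (N n) \<le> t * 2 ^ n + 1" by linarith+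
  qed
  have s: "t < s n" "s n \<le> t + (1/2)^n" for n
    using N[of n] by (simp_all add: s_def field_simps power_one_over)
  have half: "(\<lambda>n. (1/2) ^ n :: real) \<longlonglongrightarrow> 0" by (rule LIMSEQ_power_zero) simp
  have s_lim: "s \<longlonglongrightarrow> t"
  proof (rule tendsto_sandwich[where f = "\<lambda>_. t" and h = "\<lambda>n. t + (1/2)^n"])
    show "(\<lambda>n. t + (1/2) ^ n) \<longlonglongrightarrow> t" using tendsto_add[OF tendsto_const half, of t] by simp
  qed (auto intro!: always_eventually s(2) less_imp_le[OF s(1)])
  have "filterlim s (at_right t) sequentially"
    using s_lim s(1) less_imp_neq[OF s(1), symmetric] by (simp add: filterlim_at)
  moreover have "((\<lambda>s. M s \<omega>) \<longlongrightarrow> M t \<omega>) (at_right t)"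
    using right_continuous_paths[OF \<omega>, of t] t by (simp add: continuous_within)
  ultimately have "(\<lambda>n. M (s n) \<omega>) \<longlonglongrightarrow> M t \<omega>"
    by (rule filterlim_compose[rotated])
  then have "\<forall>\<^sub>F n in sequentially. M (s n) \<omega> = M t \<omega>"
    by (simp add: tendsto_discrete)
  then have "\<forall>\<^sub>F n in sequentially. surplus c M Z u (s n) \<omega> = surplus c M Z u t \<omega> + c * (s n - t)"
    by eventually_elim (simp add: surplus_def algebra_simps)
  moreover have "(\<lambda>n. surplus c M Z u t \<omega> + c * (s n - t)) \<longlonglongrightarrow> surplus c M Z u t \<omega> + c * (t - t)"
    by (intro tendsto_intros s_lim)
  ultimately have "(\<lambda>n. surplus c M Z u (s n) \<omega>) \<longlonglongrightarrow> surplus c M Z u t \<omega>"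
    by (simp add: tendsto_cong)
  moreover have "0 \<le> surplus c M Z u (s n) \<omega>" for n
    unfolding s_def by (rule dyadic) (simp add: N_def)
  ultimately show ?thesis
    by (intro LIMSEQ_le_const) auto
qed

text \<open>
The dyadic grids are nested, so the survival events decrease, and their intersection is the event
that the surplus is never negative.
\<close>

lemma dyadic_survival_tendsto_nonruin:
  assumes Z: "\<And>i. 1 \<le> i \<Longrightarrow> Z i \<in> borel_measurable P"
  shows "(\<lambda>n. prob {\<omega> \<in> space P. \<forall>N\<ge>1. 0 \<le> surplus c M Z u (real N * (1/2)^n) \<omega>})
    \<longlonglongrightarrow> nonruin_prob P c M Z u"
proof -
  define R where "R n = {\<omega> \<in> space P. \<forall>N\<ge>1. 0 \<le> surplus c M Z u (real N * (1/2)^n) \<omega>}" for n :: nat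
  have [measurable]: "surplus c M Z u (real N * (1/2)^n) \<in> borel_measurable P" for N n
    by (rule measurable_surplus[OF Z]) auto
  have R_meas [measurable]: "R n \<in> sets P" for n unfolding R_def by measurable
  have "decseq R"
  proof (rule decseq_SucI, rule subsetI)
    fix n \<omega> assume \<omega>: "\<omega> \<in> R (Suc n)"
    have "0 \<le> surplus c M Z u (real N * (1/2)^n) \<omega>" if "1 \<le> N" for N
    proof -
      have "0 \<le> surplus c M Z u (real (2 * N) * (1/2)^Suc n) \<omega>"
        using \<omega> that unfolding R_def by (auto simp del: of_nat_mult power_Suc)
      then show ?thesis by (simp add: mult_ac)
    qed
    then show "\<omega> \<in> R n" using \<omega> by (auto simp: R_def)
  qed
  then have "(\<lambda>n. prob (R n)) \<longlonglongrightarrow> prob (\<Inter>n. R n)"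
    by (intro finite_Lim_measure_decseq) auto
  also have "prob (\<Inter>n. R n) = nonruin_prob P c M Z u"
  proof -
    have "(\<Inter>n. R n) = {\<omega> \<in> space P. \<forall>t>0. 0 \<le> surplus c M Z u t \<omega>}"
      by (auto simp: R_def intro: surplus_nonneg_of_dyadic)
    moreover have "ruin_time c M Z u \<omega> < \<infinity> \<longleftrightarrow> \<not> (\<forall>t>0. 0 \<le> surplus c M Z u t \<omega>)" for \<omega>
      unfolding ruin_time_def Inf_less_iff by (auto simp: not_le)
    ultimately have "{\<omega> \<in> space P. ruin_time c M Z u \<omega> < \<infinity>} = space P - (\<Inter>n. R n)"
      by auto
    moreover have "(\<Inter>n. R n) \<in> sets P" by (intro sets.countable_INT) auto
    ultimately show ?thesis
      by (simp add: nonruin_prob_def ruin_prob_def prob_compl)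
  qed
  finally show ?thesis by (simp add: R_def)
qed

text \<open>
The process starts at 0 only almost surely, so the increment over \<open>[0, h]\<close> and the value at \<open>h\<close> agree
outside a null set.
\<close>

lemma small_time_rates:
  assumes h: "\<And>n. 0 < h n" "h \<longlonglongrightarrow> 0"
  defines "p \<equiv> \<lambda>n. distr P (count_space UNIV) (\<lambda>\<omega>. M (h n) \<omega> - M 0 \<omega>)"
  shows "j \<in> {1..k} \<Longrightarrow> (\<lambda>n. measure (p n) {j} / h n) \<longlonglongrightarrow> lam j"
    and "(\<lambda>n. measure (p n) {k<..} / h n) \<longlonglongrightarrow> 0"
proof -
  have lim_h: "filterlim h (at_right 0) sequentially"
    using h less_imp_neq[OF h(1), symmetric] by (simp add: filterlim_at)
  have [measurable]: "M (h n) \<in> measurable P (count_space UNIV)" "M 0 \<in> measurable P (count_space UNIV)" for n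
    using h(1)[of n] by (auto intro: measurable_at)
  have p: "measure (p n) X = prob {\<omega> \<in> space P. M (h n) \<omega> \<in> X}" for n X
  proof -
    have "measure (p n) X = prob {\<omega> \<in> space P. M (h n) \<omega> - M 0 \<omega> \<in> X}"
      unfolding p_def by (subst measure_distr) (auto intro!: arg_cong[where f = prob])
    also have "\<dots> = prob {\<omega> \<in> space P. M (h n) \<omega> \<in> X}"
      using start by (intro measure_eq_AE) auto
    finally show ?thesis .
  qed
  show "(\<lambda>n. measure (p n) {k<..} / h n) \<longlonglongrightarrow> 0"
    using filterlim_compose[OF smalloD_tendsto[OF large_jump_prob] lim_h] by (simp add: p)
  show "(\<lambda>n. measure (p n) {j} / h n) \<longlonglongrightarrow> lam j" if "j \<in> {1..k}"
  proof -
    have "(\<lambda>n. (measure (p n) {j} - lam j * h n) / h n) \<longlonglongrightarrow> 0"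
      using filterlim_compose[OF smalloD_tendsto[OF jump_prob[OF that]] lim_h] by (simp add: p)
    then have "(\<lambda>n. (measure (p n) {j} - lam j * h n) / h n + lam j) \<longlonglongrightarrow> 0 + lam j"
      by (rule tendsto_add) simp
    moreover have "(measure (p n) {j} - lam j * h n) / h n + lam j = measure (p n) {j} / h n" for n
      using h(1)[of n] by (simp add: field_simps)
    ultimately show ?thesis by simp
  qed
qed

end

section \<open>The non-ruin probability\<close>

text \<open>
The dyadic skeletons of the surplus supply the approximating functions: their increments are
independent, their one-step laws have the jump rates of the process, and their survival probabilities
converge to the non-ruin probability.
\<close>

theorem (in generalized_counting_process) nonruin_renewal_equation:
  fixes Z :: "nat \<Rightarrow> 'a \<Rightarrow> real" and \<mu> :: "nat \<Rightarrow> real measure" and c :: real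
  defines "\<phi> \<equiv> \<lambda>x. if x < 0 then 0 else nonruin_prob P c M Z x"
  assumes c: "0 < c" and claims: "iid_claims P Z \<mu>"
    and indep: "indep_set (process_algebra P {0..} (count_space UNIV) M) (process_algebra P {1..} borel Z)"
    and nonneg: "\<And>j. j \<in> {1..k} \<Longrightarrow> AE s in \<mu> j. 0 \<le> s"
  shows "mono \<phi>" and "\<And>a. 0 \<le> a \<Longrightarrow> c * (\<phi> a - \<phi> 0) =
    (\<integral>v. indicator {0..a} v * (\<phi> v * (\<Sum>j = 1..k. lam j * (1 - measure (\<mu> j) {..a - v}))) \<partial>lborel)"
proof -
  interpret iid_claims P Z \<mu> by fact
  define h where "h n = (1/2 :: real) ^ n" for n
  have h: "\<And>n. 0 < h n" "h \<longlonglongrightarrow> 0"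
    unfolding h_def by (simp, rule LIMSEQ_power_zero) simp
  define p where "p n = distr P (count_space UNIV) (\<lambda>\<omega>. M (h n) \<omega> - M 0 \<omega>)" for n
  define f where "f n x = (if x < 0 then 0 else
    prob {\<omega> \<in> space P. \<forall>N\<ge>1. 0 \<le> claim_walk (c * h n) (\<lambda>l. increment (h n) l \<omega>) (\<lambda>i. Z i \<omega>) x N})" for n x
  have [measurable]: "M (h n) \<in> measurable P (count_space UNIV)" "M 0 \<in> measurable P (count_space UNIV)" for n
    using h(1)[of n] by (auto intro: measurable_at)
  have p: "prob_space (p n)" "sets (p n) = sets (count_space UNIV)" for n
    unfolding p_def by (auto intro!: prob_space_distr)
  have fp: "mono (f n)" "0 \<le> x \<Longrightarrow> f n x = (\<integral>j. \<integral>s. f n (x + c * h n - s) \<partial>\<mu> j \<partial>p n)" for n x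
    unfolding f_def
    using never_ruined_fixed_point[OF p indep_increments[OF h(1)]
        distr_increment[OF h(1), folded p_def] increments_indep_claims[OF h(1) measurable_Z indep]]
    by auto
  have lim: "(\<lambda>n. f n x) \<longlonglongrightarrow> \<phi> x" for x
  proof (cases "x < 0")
    case False
    have "f n x = prob {\<omega> \<in> space P. \<forall>N\<ge>1. 0 \<le> surplus c M Z x (real N * (1/2)^n) \<omega>}" for n
    proof -
      have [measurable]: "(\<lambda>\<omega>. claim_walk (c * h n) (\<lambda>l. increment (h n) l \<omega>) (\<lambda>i. Z i \<omega>) x N) \<in> borel_measurable P" for N
        using h(1)[of n] by (intro measurable_claim_walk) auto
      have [measurable]: "surplus c M Z x (real N * (1/2)^n) \<in> borel_measurable P" for N
        by (rule measurable_surplus) auto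
      have "AE \<omega> in P. \<forall>N. claim_walk (c * h n) (\<lambda>l. increment (h n) l \<omega>) (\<lambda>i. Z i \<omega>) x N =
          surplus c M Z x (real N * (1/2)^n) \<omega>"
        using start AE_space
      proof eventually_elim
        case (elim \<omega>)
        then show ?case using h(1)[of n]
          by (simp add: claim_walk_def sum_increment surplus_def h_def mult_ac)
      qed
      then show ?thesis
        using False unfolding f_def
        by (simp, intro measure_eq_AE) auto
    qed
    then show ?thesis
      using dyadic_survival_tendsto_nonruin[of Z c x] False by (simp add: \<phi>_def)
  qed (simp add: f_def \<phi>_def)
  have f: "\<And>n x. 0 \<le> f n x" "\<And>n x. f n x \<le> 1" "\<And>n x. x < 0 \<Longrightarrow> f n x = 0"
    by (simp_all add: f_def)
  show "mono \<phi>"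
  proof (rule monoI)
    fix x y :: real assume "x \<le> y"
    then show "\<phi> x \<le> \<phi> y"
      using fp(1) by (intro LIMSEQ_le[OF lim lim]) (auto dest: monoD)
  qed
  then have [measurable]: "\<phi> \<in> borel_measurable borel" by (rule borel_measurable_mono)
  have \<phi>: "0 \<le> \<phi> x" "\<phi> x \<le> 1" "x < 0 \<Longrightarrow> \<phi> x = 0" for x
    by (simp_all add: \<phi>_def nonruin_prob_def ruin_prob_def)
  fix a :: real assume a: "0 \<le> a"
  show "c * (\<phi> a - \<phi> 0) =
    (\<integral>v. indicator {0..a} v * (\<phi> v * (\<Sum>j = 1..k. lam j * (1 - measure (\<mu> j) {..a - v}))) \<partial>lborel)"
    (is "_ = ?R")
  proof -
    have "c * (\<phi> a - \<phi> 0) = (\<integral>x. indicator {0..a} x *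
        ((\<Sum>j = 1..k. lam j) * \<phi> x - (\<Sum>j = 1..k. lam j * (\<integral>s. \<phi> (x - s) \<partial>\<mu> j))) \<partial>lborel)"
    proof (rule integro_differential_limit[where f = f and h = h and p = p and k = k and \<mu> = \<mu>])
      show "sets (p n) = UNIV" for n by (simp add: p)
      show "(\<lambda>n. measure (p n) {j} / h n) \<longlonglongrightarrow> lam j" if "j \<in> {1..k}" for j
        unfolding p_def by (rule small_time_rates(1)[OF h that])
      show "(\<lambda>n. measure (p n) {k<..} / h n) \<longlonglongrightarrow> 0"
        unfolding p_def by (rule small_time_rates(2)[OF h])
    qed (fact fp f lim c h p prob_space_block_law sets_block_law block_law_0 a)+
    also have "\<dots> = ?R"
      by (rule integrated_generator_eq_renewal)
        (fact prob_space_block_law sets_block_law nonneg \<phi> \<open>\<phi> \<in> borel_measurable borel\<close>)+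
    finally show ?thesis .
  qed
qed

theorem theorem19:
  fixes P :: "'a measure" and k :: nat and lam :: "nat \<Rightarrow> real" and c r \<alpha> u :: real
    and M :: "real \<Rightarrow> 'a \<Rightarrow> nat" and Z :: "nat \<Rightarrow> 'a \<Rightarrow> real"
  assumes "1 \<le> k" and "\<And>j. j \<in> {1..k} \<Longrightarrow> 0 < lam j"
    and "0 < c" and "0 < r" and "0 < \<alpha>"
    and "generalized_counting_process P k lam M"
    and "prob_space.indep_vars P (\<lambda>_. borel) Z {1..}"
    and "\<And>i. 1 \<le> i \<Longrightarrow> distributed P lborel (Z i) (\<lambda>x. ennreal (gamma_density r \<alpha> x))"
    and "prob_space.indep_set P (process_algebra P {0..} (count_space UNIV) M)
                                (process_algebra P {1..} borel Z)"
    and "0 < u"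
  shows "let \<Lambda> = (\<Sum>j = 1..k. lam j);
             \<phi> = nonruin_prob P c M Z;
             g = (\<lambda>x. exp (\<alpha> * x) - 1 / \<Lambda> *
                   (\<Sum>j = 1..k. lam j * (\<alpha> * x) powr (real j * r) *
                      mittag_leffler 1 (1 + real j * r) (\<alpha> * x)));
             S = (\<lambda>x. \<Sum>n. (\<Lambda> / c) ^ Suc n * conv_power g (Suc n) x)
         in (\<forall>x \<in> {0..u}. summable (\<lambda>n. (\<Lambda> / c) ^ Suc n * conv_power g (Suc n) x)) \<and>
            set_integrable lborel {0..u} (\<lambda>v. exp (\<alpha> * (u - v)) * S v) \<and>
            \<phi> u = \<phi> 0 + exp (- \<alpha> * u) * \<phi> 0 * conv (\<lambda>x. exp (\<alpha> * x)) S u"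
proof -
  interpret generalized_counting_process P k lam M by fact
  define \<mu> where "\<mu> j = distr P borel (\<lambda>\<omega>. \<Sum>i\<in>{0<..0 + j}. Z i \<omega>)" for j
  have gamma_block: "distr P borel (\<lambda>\<omega>. \<Sum>i\<in>{m<..m + j}. Z i \<omega>) =
      density lborel (\<lambda>x. ennreal (gamma_density (real j * r) \<alpha> x))" if "1 \<le> j" for m j
  proof -
    have "distributed P lborel (\<lambda>\<omega>. \<Sum>i\<in>{m<..m + j}. Z i \<omega>)
        (\<lambda>x. ennreal (gamma_density (real (card {m<..m + j}) * r) \<alpha> x))"
      using that assms(4,5,8)
      by (intro gamma_distributed_sum indep_vars_subset[OF assms(7)]) auto
    then show ?thesis
      by (simp add: distributed_distr_eq_density[symmetric] cong: distr_cong)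
  qed
  have gamma_\<mu>: "\<mu> j = density lborel (\<lambda>x. ennreal (gamma_density (real j * r) \<alpha> x))" if "1 \<le> j" for j
    unfolding \<mu>_def by (rule gamma_block[OF that])
  have "distr P borel (\<lambda>\<omega>. \<Sum>i\<in>{m<..m + j}. Z i \<omega>) = \<mu> j" for m j
  proof (cases "j = 0")
    case True
    then show ?thesis by (simp add: \<mu>_def)
  next
    case False
    then show ?thesis by (simp add: gamma_block gamma_\<mu>)
  qed
  then have claims: "iid_claims P Z \<mu>"
    using assms(7) by unfold_locales auto
  interpret iid_claims P Z \<mu> by fact
  have nonneg: "AE s in \<mu> j. 0 \<le> s" if "j \<in> {1..k}" for j
  proof -
    have j: "1 \<le> j" using that by simp
    show ?thesis
      unfolding gamma_\<mu>[OF j] by (simp add: AE_density) (auto intro!: AE_I2 simp: gamma_density_def)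
  qed
  define \<phi> where "\<phi> x = (if x < 0 then 0 else nonruin_prob P c M Z x)" for x
  have "mono \<phi>"
    unfolding \<phi>_def[abs_def]
    by (rule nonruin_renewal_equation(1)) (fact assms(3) claims assms(9) nonneg)+
  then have [measurable]: "\<phi> \<in> borel_measurable borel" by (rule borel_measurable_mono)
  have renewal: "c * (\<phi> a - \<phi> 0) = (\<integral>v. indicator {0..a} v *
      (\<phi> v * (\<Sum>j = 1..k. lam j * (1 - measure (\<mu> j) {..a - v}))) \<partial>lborel)" if "0 \<le> a" for a
    unfolding \<phi>_def
    by (rule nonruin_renewal_equation(2)) (fact assms(3) claims assms(9) nonneg that)+
  have \<phi>: "0 \<le> \<phi> x" "\<phi> x \<le> 1" for x
    by (simp_all add: \<phi>_def nonruin_prob_def ruin_prob_def)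
  define \<Lambda> where "\<Lambda> = (\<Sum>j = 1..k. lam j)"
  have \<Lambda>: "0 < \<Lambda>" unfolding \<Lambda>_def using assms(1,2) by (intro sum_pos) auto
  define g where "g x = exp (\<alpha> * x) - 1 / \<Lambda> *
    (\<Sum>j = 1..k. lam j * (\<alpha> * x) powr (real j * r) * mittag_leffler 1 (1 + real j * r) (\<alpha> * x))" for x
  have g_meas [measurable]: "g \<in> borel_measurable borel"
    unfolding g_def[abs_def] mittag_leffler_def by measurable
  have g_tail: "g x = exp (\<alpha> * x) * ((\<Sum>j = 1..k. lam j * (1 - measure (\<mu> j) {..x})) / \<Lambda>)"
    if "0 \<le> x" for x
  proof -
    have summand: "lam j * (\<alpha> * x) powr (real j * r) * mittag_leffler 1 (1 + real j * r) (\<alpha> * x) =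
        exp (\<alpha> * x) * (lam j * measure (\<mu> j) {..x})" if "j \<in> {1..k}" for j
    proof -
      have j: "1 \<le> j" "0 < real j * r" using that assms(4) by simp_all
      show ?thesis
        unfolding gamma_\<mu>[OF j(1)] gamma_cdf[OF j(2) assms(5) \<open>0 \<le> x\<close>] by (simp add: exp_minus)
    qed
    then have "g x = exp (\<alpha> * x) - 1 / \<Lambda> * (\<Sum>j = 1..k. exp (\<alpha> * x) * (lam j * measure (\<mu> j) {..x}))"
      unfolding g_def by (simp only: sum.cong[OF refl summand])
    also have "\<dots> = exp (\<alpha> * x) * ((\<Lambda> - (\<Sum>j = 1..k. lam j * measure (\<mu> j) {..x})) / \<Lambda>)"
      unfolding sum_distrib_left[symmetric] using \<Lambda>
      by (simp add: diff_divide_distrib right_diff_distrib)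
    also have "\<Lambda> - (\<Sum>j = 1..k. lam j * measure (\<mu> j) {..x}) = (\<Sum>j = 1..k. lam j * (1 - measure (\<mu> j) {..x}))"
      by (simp add: \<Lambda>_def sum_subtractf right_diff_distrib)
    finally show ?thesis .
  qed
  have exp_le: "\<bar>exp (\<alpha> * x)\<bar> \<le> exp (\<alpha> * u)" if "x \<in> {0..u}" for x
    using that assms(5) by simp
  have g_le: "\<bar>g x\<bar> \<le> exp (\<alpha> * u)" if x: "x \<in> {0..u}" for x
  proof -
    have "0 \<le> x" using x by simp
    have F: "0 \<le> 1 - measure (\<mu> j) {..x}" "1 - measure (\<mu> j) {..x} \<le> 1" for j
      using prob_space.prob_le_1[OF prob_space_block_law, of j] by simp_all
    have "0 \<le> (\<Sum>j = 1..k. lam j * (1 - measure (\<mu> j) {..x}))"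
      using F assms(2) by (intro sum_nonneg mult_nonneg_nonneg) (auto intro: less_imp_le)
    moreover have "(\<Sum>j = 1..k. lam j * (1 - measure (\<mu> j) {..x})) \<le> \<Lambda>"
      unfolding \<Lambda>_def using F assms(2) by (intro sum_mono mult_left_le) (auto intro: less_imp_le)
    ultimately have "\<bar>(\<Sum>j = 1..k. lam j * (1 - measure (\<mu> j) {..x})) / \<Lambda>\<bar> \<le> 1"
      using \<Lambda> by simp
    then have "\<bar>g x\<bar> \<le> exp (\<alpha> * x) * 1"
      using x unfolding g_tail[OF \<open>0 \<le> x\<close>] abs_mult by (intro mult_mono) simp_all
    then show ?thesis using exp_le[OF x] by (simp only: abs_exp_cancel mult_1_right)
  qed
  \<comment> \<open>The exponential weight turns the kernel 1 - F into g.\<close>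
  define F where "F x = exp (\<alpha> * x) * \<phi> x" for x
  have [measurable]: "F \<in> borel_measurable borel" unfolding F_def[abs_def] by measurable
  have F_le: "\<bar>F x\<bar> \<le> exp (\<alpha> * u)" if x: "x \<in> {0..u}" for x
    using mult_mono[of "exp (\<alpha> * x)" "exp (\<alpha> * u)" "\<phi> x" 1] \<phi>[of x] exp_le[OF x]
    by (simp add: F_def abs_mult)
  have volterra: "F a = \<phi> 0 * exp (\<alpha> * a) + \<Lambda> / c * conv g F a" if "a \<in> {0..u}" for a
  proof -
    have "exp (\<alpha> * a) * (c * (\<phi> a - \<phi> 0)) = (\<integral>v. exp (\<alpha> * a) * (indicator {0..a} v *
        (\<phi> v * (\<Sum>j = 1..k. lam j * (1 - measure (\<mu> j) {..a - v})))) \<partial>lborel)"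
      using that by (simp add: renewal)
    also have "\<dots> = (\<integral>v. \<Lambda> * (indicator {0..a} v * (g (a - v) * F v)) \<partial>lborel)"
    proof (rule Bochner_Integration.integral_cong[OF refl])
      fix v :: real
      show "exp (\<alpha> * a) * (indicator {0..a} v * (\<phi> v * (\<Sum>j = 1..k. lam j * (1 - measure (\<mu> j) {..a - v})))) =
          \<Lambda> * (indicator {0..a} v * (g (a - v) * F v))"
      proof (cases "v \<in> {0..a}")
        case True
        have "exp (\<alpha> * a) = exp (\<alpha> * (a - v)) * exp (\<alpha> * v)"
          by (simp add: exp_add[symmetric] algebra_simps)
        then show ?thesis using True \<Lambda> by (simp add: g_tail F_def)
      qed simp
    qed
    also have "\<dots> = \<Lambda> * conv g F a"
      by (simp add: conv_def set_lebesgue_integral_def)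
    finally show ?thesis
      using assms(3) by (simp add: F_def field_simps)
  qed
  note resolvent = Volterra_resolvent[where g = g and e = "\<lambda>x. exp (\<alpha> * x)" and F = F and u = u,
      OF _ _ _ _ g_le exp_le F_le volterra]
  define S where "S x = (\<Sum>n. (\<Lambda> / c) ^ Suc n * conv_power g (Suc n) x)" for x
  have "F u = \<phi> 0 * exp (\<alpha> * u) + \<phi> 0 * conv (\<lambda>x. exp (\<alpha> * x)) S u"
    unfolding S_def using assms(10) by (intro resolvent(3)) simp_all
  then have "\<phi> u = \<phi> 0 + exp (- \<alpha> * u) * \<phi> 0 * conv (\<lambda>x. exp (\<alpha> * x)) S u"
    by (simp add: F_def exp_minus field_simps)
  then have "nonruin_prob P c M Z u = nonruin_prob P c M Z 0 +
      exp (- \<alpha> * u) * nonruin_prob P c M Z 0 * conv (\<lambda>x. exp (\<alpha> * x)) S u"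
    using assms(10) by (simp add: \<phi>_def)
  moreover have "set_integrable lborel {0..u} (\<lambda>v. exp (\<alpha> * (u - v)) * S v)"
    unfolding S_def using assms(10) by (intro resolvent(2)) simp_all
  moreover have "\<forall>x\<in>{0..u}. summable (\<lambda>n. (\<Lambda> / c) ^ Suc n * conv_power g (Suc n) x)"
    using assms(10) by (intro ballI resolvent(1)) simp_all
  ultimately show ?thesis
    unfolding Let_def \<Lambda>_def[symmetric] g_def[symmetric, abs_def] S_def[symmetric, abs_def] by blast
qed

end
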